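(* Let $M\subseteq\mathbb{D}^d$ be a constructible set, let $n\ge 0$, let $A\subseteq\mathbb{S}^{d-1}$ be an arbitrary subset of directions, and let $(X,d)$ be either $(\mathbb{I},d_2)$ or $(\Theta,d_g)$. Suppose we are given the functor $G^X:\mathbb{AX}\to\mathrm{Vect}$ that records the degree-$n$ persistent homology of $M$ in every direction $v\in A$, i.e. $G^X(v,\alpha)=H_n(M_{v,\alpha})$ if $X=\mathbb{I}$ and $G^X(v,\alpha)=H_n(M_{v,\cos\alpha})$ if $X=\Theta$, together with the inclusion-induced maps on homology $G^X(v,\alpha)\to G^X(w,\beta)$ for every morphism $(v,\alpha)\to(w,\beta)$ of $\mathbb{AX}$. Let $\hat G:\mathbb{S}^{d-1}\mathbb{X}\to\mathrm{Vect}$ be any one of the left, right, or center Kan extensions of $G^X$ along the inclusion $\mathbb{AX}\hookrightarrow\mathbb{S}^{d-1}\mathbb{X}$. Then the map $$\overline{\mathrm{PHT}}^X_n(M):\mathbb{S}^{d-1}\to\mathrm{Vect}^X,\qquad w\mapsto \hat G(w,\cdot)$$ is $1$-Lipschitz with respect to $d$ on $\mathbb{S}^{d-1}$ and the interleaving distance $d_{\mathrm{Int}}$ on $\mathrm{Vect}^X$.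
   Context: Fix a field $\Bbbk$; $\mathrm{Vect}$ is the category of $\Bbbk$-vector spaces and $H_n$ is homology with coefficients in $\Bbbk$. Fix an o-minimal structure $\mathcal{O}=\{\mathcal{O}_d\}$: for each $d\ge 0$ a boolean algebra $\mathcal{O}_d$ of subsets of $\mathbb{R}^d$, with $\mathcal{O}_1$ consisting only of finite unions of points and intervals, closed under $A\mapsto A\times\mathbb{R},\ \mathbb{R}\times A$ and under axis-aligned projections $\mathbb{R}^{d+1}\to\mathbb{R}^d$, and containing all semialgebraic sets. A constructible set is a compact member of some $\mathcal{O}_d$. $\mathbb{D}^d$ is the closed unit ball in $\mathbb{R}^d$, $\mathbb{S}^{d-1}$ the unit sphere. For $M\subseteq\mathbb{D}^d$, $v\in\mathbb{S}^{d-1}$, $t\in\mathbb{R}$, put $M_{v,t}=\{x\in M: x\cdot v\le t\}$. $\mathbb{I}=[-1,1]$, $\Theta=[-\pi,0]$; $d_2(v,w)=\|v-w\|_2$ and $d_g(v,w)=\arccos(v\cdot w)$ on $\mathbb{S}^{d-1}$. The interval $X$ is viewed as a category via $\le$, and $\mathrm{Vect}^X$ is the category of functors $X\to\mathrm{Vect}$ ($X$-persistence modules). Interleaving distance: for $\varepsilon\ge0$ let $T_\varepsilon:X\to X$, $T_\varepsilon(x)=\min(x+\varepsilon,\sup X)$. An $\varepsilon$-interleaving between $U,V\in\mathrm{Vect}^X$ is a pair of natural transformations $\Phi:U\Rightarrow VT_\varepsilon$, $\Psi:V\Rightarrow UT_\varepsilon$ with $(\Psi T_\varepsilon)\Phi=U\sigma_{2\varepsilon}$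 and $(\Phi T_\varepsilon)\Psi=V\sigma_{2\varepsilon}$, where $\sigma_{2\varepsilon}:\mathrm{Id}\Rightarrow T_{2\varepsilon}$ is the canonical natural transformation. $d_{\mathrm{Int}}(U,V)$ is the infimum of the $\varepsilon\ge0$ for which an $\varepsilon$-interleaving exists ($\infty$ if none). Space-time category: for $A\subseteq\mathbb{S}^{d-1}$, $\mathbb{AX}$ is the pre-order category with object set $A\times X$ and a unique morphism $(v,\alpha)\to(w,\beta)$ exactly when $\alpha+d(v,w)\le\beta$ or $\beta=\sup X$. Whenever such a morphism exists, the sublevel set of $M$ at $(v,\alpha)$ is contained in that at $(w,\beta)$. $\mathbb{S}^{d-1}\mathbb{X}$ is this category for $A=\mathbb{S}^{d-1}$. Kan extensions: for $(w,\beta)\in\mathbb{S}^{d-1}\mathbb{X}$, the left Kan extension is $\mathrm{Lan}(w,\beta)=\operatorname{colim} G^X(v,\alpha)$ over the full subcategory of $(v,\alpha)\in\mathbb{AX}$ admitting a morphism $(v,\alpha)\to(w,\beta)$; the right Kan extension is $\mathrm{Ran}(w,\beta)=\lim G^X(v,\alpha)$ over the full subcategory of $(v,\alpha)\in\mathbb{AX}$ admitting a morphism $(w,\beta)\to(v,\alpha)$; the center Kan extension assigns to $(w,\beta)$ the image of the canonical map $\mathrm{Lan}(w,\beta)\to\mathrm{Ran}(w,\beta)$ (induced by the universal properties from the maps of $G^X$ on composites $(v,\alpha)\to(w,\beta)\to(v',\alpha')$). *)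

theory Defs
  imports "HOL-Analysis.Analysis" "HOL-Homology.Homology" "HOL-Algebra.Module"
begin

text \<open>
  The space \<open>\<real>\<^sup>d\<close> is \<open>topspace (Euclidean_space d)\<close>, i.e. the sequences that vanish from index \<open>d\<close> on,
  so that the dimension is an ordinary natural number. A vector space over the field \<open>K\<close> is a
  \<open>module\<close> over \<open>K\<close> in the sense of HOL-Algebra; the ring multiplication fields of the underlying
  record are not used.
\<close>

section \<open>Euclidean geometry\<close>

abbreviation Rn :: "nat \<Rightarrow> (nat \<Rightarrow> real) set" where
  "Rn d \<equiv> topspace (Euclidean_space d)"

definition dot :: "nat \<Rightarrow> (nat \<Rightarrow> real) \<Rightarrow> (nat \<Rightarrow> real) \<Rightarrow> real" where
  "dot d x y = (\<Sum>i<d. x i * y i)"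

definition unit_disc :: "nat \<Rightarrow> (nat \<Rightarrow> real) set" where
  "unit_disc d = {x \<in> Rn d. L2_set x {..<d} \<le> 1}"

text \<open>This is \<open>S\<^sup>d\<^sup>-\<^sup>1\<close>; unlike \<open>nsphere (d - 1)\<close> it is empty for \<open>d = 0\<close>.\<close>

definition unit_sphere :: "nat \<Rightarrow> (nat \<Rightarrow> real) set" where
  "unit_sphere d = {x \<in> Rn d. L2_set x {..<d} = 1}"

definition chordal_dist :: "nat \<Rightarrow> (nat \<Rightarrow> real) \<Rightarrow> (nat \<Rightarrow> real) \<Rightarrow> real" where
  "chordal_dist d v w = L2_set (\<lambda>i. v i - w i) {..<d}"

definition geodesic_dist :: "nat \<Rightarrow> (nat \<Rightarrow> real) \<Rightarrow> (nat \<Rightarrow> real) \<Rightarrow> real" where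
  "geodesic_dist d v w = arccos (dot d v w)"

definition sublevel :: "nat \<Rightarrow> (nat \<Rightarrow> real) set \<Rightarrow> (nat \<Rightarrow> real) \<Rightarrow> real \<Rightarrow> (nat \<Rightarrow> real) set" where
  "sublevel d M v t = {x \<in> M. dot d x v \<le> t}"


section \<open>O-minimal structures\<close>

inductive poly_fun :: "nat \<Rightarrow> ((nat \<Rightarrow> real) \<Rightarrow> real) \<Rightarrow> bool" for d where
  const: "poly_fun d (\<lambda>x. c)"
| coord: "i < d \<Longrightarrow> poly_fun d (\<lambda>x. x i)"
| add: "poly_fun d p \<Longrightarrow> poly_fun d q \<Longrightarrow> poly_fun d (\<lambda>x. p x + q x)"
| mult: "poly_fun d p \<Longrightarrow> poly_fun d q \<Longrightarrow> poly_fun d (\<lambda>x. p x * q x)"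

inductive semialgebraic :: "nat \<Rightarrow> (nat \<Rightarrow> real) set \<Rightarrow> bool" for d where
  zero: "poly_fun d p \<Longrightarrow> semialgebraic d {x \<in> Rn d. p x = 0}"
| pos: "poly_fun d p \<Longrightarrow> semialgebraic d {x \<in> Rn d. p x > 0}"
| compl: "semialgebraic d S \<Longrightarrow> semialgebraic d (Rn d - S)"
| union: "semialgebraic d S \<Longrightarrow> semialgebraic d T \<Longrightarrow> semialgebraic d (S \<union> T)"

text \<open>
  Points are degenerate intervals, and intervals may be unbounded. \<open>Sigma_Algebra.algebra\<close> is the
  locale of boolean algebras of subsets of a given set. The two product conditions are \<open>S \<times> \<real>\<close> and
  \<open>\<real> \<times> S\<close>; the projection condition deletes an arbitrary coordinate.
\<close>

definition o_minimal :: "(nat \<Rightarrow> (nat \<Rightarrow> real) set set) \<Rightarrow> bool" where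
  "o_minimal Ostr \<longleftrightarrow>
     (\<forall>d. Sigma_Algebra.algebra (Rn d) (Ostr d)) \<and>
     (\<forall>S \<in> Ostr 1. \<exists>F. finite F \<and> (\<forall>I \<in> F. is_interval I) \<and> (\<lambda>x. x 0) ` S = \<Union>F) \<and>
     (\<forall>d. \<forall>S \<in> Ostr d. {x \<in> Rn (Suc d). (\<lambda>i. if i < d then x i else 0) \<in> S} \<in> Ostr (Suc d)) \<and>
     (\<forall>d. \<forall>S \<in> Ostr d. {x \<in> Rn (Suc d). (\<lambda>i. x (Suc i)) \<in> S} \<in> Ostr (Suc d)) \<and>
     (\<forall>d. \<forall>S \<in> Ostr (Suc d). \<forall>j \<le> d.
        (\<lambda>x i. if i < j then x i else x (Suc i)) ` S \<in> Ostr d) \<and>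
     (\<forall>d S. semialgebraic d S \<longrightarrow> S \<in> Ostr d)"

definition constructible :: "(nat \<Rightarrow> (nat \<Rightarrow> real) set set) \<Rightarrow> nat \<Rightarrow> (nat \<Rightarrow> real) set \<Rightarrow> bool" where
  "constructible Ostr d M \<longleftrightarrow> M \<in> Ostr d \<and> compactin (Euclidean_space d) M"


section \<open>Vector spaces\<close>

definition linear_maps ::
  "('k, 'm) ring_scheme \<Rightarrow> ('k, 'v) module \<Rightarrow> ('k, 'w) module \<Rightarrow> ('v \<Rightarrow> 'w) set" where
  "linear_maps K V W =
     {f \<in> carrier V \<rightarrow> carrier W.
        (\<forall>x \<in> carrier V. \<forall>y \<in> carrier V. f (x \<oplus>\<^bsub>V\<^esub> y) = f x \<oplus>\<^bsub>W\<^esub> f y) \<and>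
        (\<forall>a \<in> carrier K. \<forall>x \<in> carrier V. f (a \<odot>\<^bsub>V\<^esub> x) = a \<odot>\<^bsub>W\<^esub> f x)}"

definition mspan :: "('k, 'm) ring_scheme \<Rightarrow> ('k, 'v) module \<Rightarrow> 'v set \<Rightarrow> 'v set" where
  "mspan K V S = \<Inter>{H. submodule H K V \<and> S \<subseteq> H}"

definition quotient_module :: "('k, 'v) module \<Rightarrow> 'v set \<Rightarrow> ('k, 'v set) module" where
  "quotient_module V H =
     \<lparr>carrier = a_rcosets\<^bsub>V\<^esub> H, mult = undefined, one = undefined, zero = H, add = set_add V,
      smult = (\<lambda>a C. \<Union>x \<in> C. H +>\<^bsub>V\<^esub> (a \<odot>\<^bsub>V\<^esub> x))\<rparr>"


section \<open>Singular homology with coefficients in a field\<close>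

definition chains ::
  "('k, 'm) ring_scheme \<Rightarrow> nat \<Rightarrow> 'a topology \<Rightarrow> ('k, ((nat \<Rightarrow> real) \<Rightarrow> 'a) \<Rightarrow> 'k) module" where
  "chains K p X =
     \<lparr>carrier = {c. (\<forall>\<sigma>. c \<sigma> \<in> carrier K) \<and> finite {\<sigma>. c \<sigma> \<noteq> \<zero>\<^bsub>K\<^esub>} \<and>
                    (\<forall>\<sigma>. c \<sigma> \<noteq> \<zero>\<^bsub>K\<^esub> \<longrightarrow> singular_simplex p X \<sigma>)},
      mult = undefined, one = undefined,
      zero = (\<lambda>\<sigma>. \<zero>\<^bsub>K\<^esub>), add = (\<lambda>c c' \<sigma>. c \<sigma> \<oplus>\<^bsub>K\<^esub> c' \<sigma>),
      smult = (\<lambda>a c \<sigma>. a \<otimes>\<^bsub>K\<^esub> c \<sigma>)\<rparr>"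

text \<open>
  The \<open>K\<close>-linear extension of the integral boundary operator \<open>chain_boundary\<close>: the integer coefficient
  of \<open>\<tau>\<close> in the boundary of \<open>\<sigma>\<close> acts on the coefficient of \<open>\<sigma>\<close> in \<open>c\<close>.
\<close>

definition boundary_map ::
  "('k, 'm) ring_scheme \<Rightarrow> nat \<Rightarrow> (((nat \<Rightarrow> real) \<Rightarrow> 'a) \<Rightarrow> 'k) \<Rightarrow> ((nat \<Rightarrow> real) \<Rightarrow> 'a) \<Rightarrow> 'k" where
  "boundary_map K p c =
     (\<lambda>\<tau>. \<Oplus>\<^bsub>K\<^esub>\<sigma> \<in> {\<sigma>. c \<sigma> \<noteq> \<zero>\<^bsub>K\<^esub>}.
        add_pow K (poly_mapping.lookup (chain_boundary p (frag_of \<sigma>)) \<tau> :: int) (c \<sigma>))"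

definition cycles ::
  "('k, 'm) ring_scheme \<Rightarrow> nat \<Rightarrow> 'a topology \<Rightarrow> (((nat \<Rightarrow> real) \<Rightarrow> 'a) \<Rightarrow> 'k) set" where
  "cycles K p X = {c \<in> carrier (chains K p X). boundary_map K p c = (\<lambda>\<sigma>. \<zero>\<^bsub>K\<^esub>)}"

definition boundaries ::
  "('k, 'm) ring_scheme \<Rightarrow> nat \<Rightarrow> 'a topology \<Rightarrow> (((nat \<Rightarrow> real) \<Rightarrow> 'a) \<Rightarrow> 'k) set" where
  "boundaries K p X = boundary_map K (Suc p) ` carrier (chains K (Suc p) X)"

definition homology ::
  "('k, 'm) ring_scheme \<Rightarrow> nat \<Rightarrow> 'a topology \<Rightarrow> ('k, (((nat \<Rightarrow> real) \<Rightarrow> 'a) \<Rightarrow> 'k) set) module" where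
  "homology K p X = quotient_module ((chains K p X)\<lparr>carrier := cycles K p X\<rparr>) (boundaries K p X)"

text \<open>
  An inclusion of a subspace into \<open>Y\<close> sends every singular simplex to itself, so the induced map
  sends the class of a cycle \<open>c\<close> to the class of the same \<open>c\<close> modulo the boundaries of \<open>Y\<close>.
\<close>

definition homology_incl ::
  "('k, 'm) ring_scheme \<Rightarrow> nat \<Rightarrow> 'a topology \<Rightarrow>
     (((nat \<Rightarrow> real) \<Rightarrow> 'a) \<Rightarrow> 'k) set \<Rightarrow> (((nat \<Rightarrow> real) \<Rightarrow> 'a) \<Rightarrow> 'k) set" where
  "homology_incl K p Y C = (\<Union>c \<in> C. boundaries K p Y +>\<^bsub>chains K p Y\<^esub> c)"


section \<open>Functors from a preorder to vector spaces\<close>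

text \<open>
  A preorder category is given by a set \<open>P\<close> of objects and a relation \<open>r\<close>, where \<open>r p q\<close> says that
  there is a (unique) morphism from \<open>p\<close> to \<open>q\<close>; \<open>mor F p q\<close> is the value of \<open>F\<close> on it.
\<close>

record ('o, 'k, 'v) diagram =
  obj :: "'o \<Rightarrow> ('k, 'v) module"
  mor :: "'o \<Rightarrow> 'o \<Rightarrow> 'v \<Rightarrow> 'v"

definition vect_functor ::
  "('k, 'm) ring_scheme \<Rightarrow> 'o set \<Rightarrow> ('o \<Rightarrow> 'o \<Rightarrow> bool) \<Rightarrow> ('o, 'k, 'v) diagram \<Rightarrow> bool" where
  "vect_functor K P r F \<longleftrightarrow>
     (\<forall>p \<in> P. module K (obj F p)) \<and>
     (\<forall>p \<in> P. \<forall>q \<in> P. r p q \<longrightarrow> mor F p q \<in> linear_maps K (obj F p) (obj F q)) \<and>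
     (\<forall>p \<in> P. \<forall>x \<in> carrier (obj F p). mor F p p x = x) \<and>
     (\<forall>p \<in> P. \<forall>q \<in> P. \<forall>s \<in> P. r p q \<longrightarrow> r q s \<longrightarrow>
        (\<forall>x \<in> carrier (obj F p). mor F q s (mor F p q x) = mor F p s x))"

definition nat_trans ::
  "('k, 'm) ring_scheme \<Rightarrow> 'o set \<Rightarrow> ('o \<Rightarrow> 'o \<Rightarrow> bool) \<Rightarrow>
     ('o, 'k, 'v) diagram \<Rightarrow> ('o, 'k, 'w) diagram \<Rightarrow> ('o \<Rightarrow> 'v \<Rightarrow> 'w) \<Rightarrow> bool" where
  "nat_trans K P r F G \<Phi> \<longleftrightarrow>
     (\<forall>p \<in> P. \<Phi> p \<in> linear_maps K (obj F p) (obj G p)) \<and>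
     (\<forall>p \<in> P. \<forall>q \<in> P. r p q \<longrightarrow>
        (\<forall>x \<in> carrier (obj F p). \<Phi> q (mor F p q x) = mor G p q (\<Phi> p x)))"

definition precomp :: "('o, 'k, 'v) diagram \<Rightarrow> ('i \<Rightarrow> 'o) \<Rightarrow> ('i, 'k, 'v) diagram" where
  "precomp F T = \<lparr>obj = (\<lambda>i. obj F (T i)), mor = (\<lambda>i j. mor F (T i) (T j))\<rparr>"


section \<open>Limits, colimits and Kan extensions\<close>

definition product_module :: "'o set \<Rightarrow> ('o, 'k, 'v) diagram \<Rightarrow> ('k, 'o \<Rightarrow> 'v) module" where
  "product_module J F =
     \<lparr>carrier = (\<Pi>\<^sub>E j \<in> J. carrier (obj F j)), mult = undefined, one = undefined,
      zero = (\<lambda>j \<in> J. \<zero>\<^bsub>obj F j\<^esub>),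
      add = (\<lambda>x y. \<lambda>j \<in> J. x j \<oplus>\<^bsub>obj F j\<^esub> y j),
      smult = (\<lambda>a x. \<lambda>j \<in> J. a \<odot>\<^bsub>obj F j\<^esub> x j)\<rparr>"

definition direct_sum :: "'o set \<Rightarrow> ('o, 'k, 'v) diagram \<Rightarrow> ('k, 'o \<Rightarrow> 'v) module" where
  "direct_sum J F = (product_module J F)
     \<lparr>carrier := {x \<in> carrier (product_module J F). finite {j \<in> J. x j \<noteq> \<zero>\<^bsub>obj F j\<^esub>}}\<rparr>"

definition direct_sum_in :: "'o set \<Rightarrow> ('o, 'k, 'v) diagram \<Rightarrow> 'o \<Rightarrow> 'v \<Rightarrow> 'o \<Rightarrow> 'v" where
  "direct_sum_in J F i x = (\<lambda>j \<in> J. if j = i then x else \<zero>\<^bsub>obj F j\<^esub>)"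

text \<open>
  The limit over the full subcategory on \<open>J\<close> consists of the compatible families; \<open>lim_lift\<close> is the
  map into it induced by a cone \<open>\<psi>\<close>.
\<close>

definition lim_module ::
  "'o set \<Rightarrow> ('o \<Rightarrow> 'o \<Rightarrow> bool) \<Rightarrow> ('o, 'k, 'v) diagram \<Rightarrow> ('k, 'o \<Rightarrow> 'v) module" where
  "lim_module J r F = (product_module J F)
     \<lparr>carrier := {x \<in> carrier (product_module J F).
        \<forall>i \<in> J. \<forall>j \<in> J. r i j \<longrightarrow> mor F i j (x i) = x j}\<rparr>"

definition lim_lift :: "'o set \<Rightarrow> ('o \<Rightarrow> 'u \<Rightarrow> 'v) \<Rightarrow> 'u \<Rightarrow> 'o \<Rightarrow> 'v" where
  "lim_lift J \<psi> u = (\<lambda>j \<in> J. \<psi> j u)"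

text \<open>
  The colimit is the quotient of the direct sum that identifies each summand's elements with their
  images; \<open>colim_in\<close> are the legs of the universal cocone and \<open>colim_desc\<close> is the map from the
  colimit to \<open>W\<close> induced by a cocone \<open>\<psi>\<close> (computed on any representative of a coset).
\<close>

definition colim_rel ::
  "('k, 'm) ring_scheme \<Rightarrow> 'o set \<Rightarrow> ('o \<Rightarrow> 'o \<Rightarrow> bool) \<Rightarrow> ('o, 'k, 'v) diagram \<Rightarrow> ('o \<Rightarrow> 'v) set" where
  "colim_rel K J r F = mspan K (direct_sum J F)
     {direct_sum_in J F i x \<ominus>\<^bsub>direct_sum J F\<^esub> direct_sum_in J F j (mor F i j x) | i j x.
        i \<in> J \<and> j \<in> J \<and> r i j \<and> x \<in> carrier (obj F i)}"

definition colim_module ::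
  "('k, 'm) ring_scheme \<Rightarrow> 'o set \<Rightarrow> ('o \<Rightarrow> 'o \<Rightarrow> bool) \<Rightarrow> ('o, 'k, 'v) diagram \<Rightarrow>
     ('k, ('o \<Rightarrow> 'v) set) module" where
  "colim_module K J r F = quotient_module (direct_sum J F) (colim_rel K J r F)"

definition colim_in ::
  "('k, 'm) ring_scheme \<Rightarrow> 'o set \<Rightarrow> ('o \<Rightarrow> 'o \<Rightarrow> bool) \<Rightarrow> ('o, 'k, 'v) diagram \<Rightarrow>
     'o \<Rightarrow> 'v \<Rightarrow> ('o \<Rightarrow> 'v) set" where
  "colim_in K J r F i x = colim_rel K J r F +>\<^bsub>direct_sum J F\<^esub> direct_sum_in J F i x"

definition colim_desc ::
  "'o set \<Rightarrow> ('o, 'k, 'v) diagram \<Rightarrow> ('k, 'w) module \<Rightarrow> ('o \<Rightarrow> 'v \<Rightarrow> 'w) \<Rightarrow> ('o \<Rightarrow> 'v) set \<Rightarrow> 'w" where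
  "colim_desc J F W \<psi> C =
     the_elem ((\<lambda>x. \<Oplus>\<^bsub>W\<^esub>j \<in> {j \<in> J. x j \<noteq> \<zero>\<^bsub>obj F j\<^esub>}. \<psi> j (x j)) ` C)"

text \<open>
  Kan extensions of a functor \<open>G\<close> on the full subcategory with object set \<open>Q\<close> of a preorder category
  with relation \<open>r\<close>, evaluated pointwise at objects \<open>p\<close> of the ambient category.
\<close>

definition left_kan ::
  "('k, 'm) ring_scheme \<Rightarrow> 'o set \<Rightarrow> ('o \<Rightarrow> 'o \<Rightarrow> bool) \<Rightarrow> ('o, 'k, 'v) diagram \<Rightarrow>
     ('o, 'k, ('o \<Rightarrow> 'v) set) diagram" where
  "left_kan K Q r G =
     \<lparr>obj = (\<lambda>p. colim_module K {q \<in> Q. r q p} r G),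
      mor = (\<lambda>p p'. colim_desc {q \<in> Q. r q p} G (colim_module K {q \<in> Q. r q p'} r G)
                      (colim_in K {q \<in> Q. r q p'} r G))\<rparr>"

definition right_kan ::
  "'o set \<Rightarrow> ('o \<Rightarrow> 'o \<Rightarrow> bool) \<Rightarrow> ('o, 'k, 'v) diagram \<Rightarrow> ('o, 'k, 'o \<Rightarrow> 'v) diagram" where
  "right_kan Q r G =
     \<lparr>obj = (\<lambda>p. lim_module {q \<in> Q. r p q} r G),
      mor = (\<lambda>p p'. lim_lift {q \<in> Q. r p' q} (\<lambda>q x. x q))\<rparr>"

definition kan_comparison ::
  "'o set \<Rightarrow> ('o \<Rightarrow> 'o \<Rightarrow> bool) \<Rightarrow> ('o, 'k, 'v) diagram \<Rightarrow> 'o \<Rightarrow> ('o \<Rightarrow> 'v) set \<Rightarrow> 'o \<Rightarrow> 'v" where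
  "kan_comparison Q r G p =
     colim_desc {q \<in> Q. r q p} G (obj (right_kan Q r G) p)
       (\<lambda>i. lim_lift {q \<in> Q. r p q} (\<lambda>j. mor G i j))"

definition center_kan ::
  "('k, 'm) ring_scheme \<Rightarrow> 'o set \<Rightarrow> ('o \<Rightarrow> 'o \<Rightarrow> bool) \<Rightarrow> ('o, 'k, 'v) diagram \<Rightarrow>
     ('o, 'k, 'o \<Rightarrow> 'v) diagram" where
  "center_kan K Q r G =
     \<lparr>obj = (\<lambda>p. (obj (right_kan Q r G) p)
              \<lparr>carrier := kan_comparison Q r G p ` carrier (obj (left_kan K Q r G) p)\<rparr>),
      mor = mor (right_kan Q r G)\<rparr>"


section \<open>Interleavings\<close>

definition shift :: "real set \<Rightarrow> real \<Rightarrow> real \<Rightarrow> real" where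
  "shift X \<epsilon> x = min (x + \<epsilon>) (Sup X)"

definition interleaving ::
  "('k, 'm) ring_scheme \<Rightarrow> real set \<Rightarrow> real \<Rightarrow> (real, 'k, 'v) diagram \<Rightarrow> (real, 'k, 'w) diagram \<Rightarrow>
     (real \<Rightarrow> 'v \<Rightarrow> 'w) \<Rightarrow> (real \<Rightarrow> 'w \<Rightarrow> 'v) \<Rightarrow> bool" where
  "interleaving K X \<epsilon> U V \<Phi> \<Psi> \<longleftrightarrow>
     nat_trans K X (\<le>) U (precomp V (shift X \<epsilon>)) \<Phi> \<and>
     nat_trans K X (\<le>) V (precomp U (shift X \<epsilon>)) \<Psi> \<and>
     (\<forall>x \<in> X. \<forall>u \<in> carrier (obj U x).
        \<Psi> (shift X \<epsilon> x) (\<Phi> x u) = mor U x (shift X (2 * \<epsilon>) x) u) \<and>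
     (\<forall>x \<in> X. \<forall>v \<in> carrier (obj V x).
        \<Phi> (shift X \<epsilon> x) (\<Psi> x v) = mor V x (shift X (2 * \<epsilon>) x) v)"

definition interleaving_dist ::
  "('k, 'm) ring_scheme \<Rightarrow> real set \<Rightarrow> (real, 'k, 'v) diagram \<Rightarrow> (real, 'k, 'w) diagram \<Rightarrow> ennreal" where
  "interleaving_dist K X U V =
     Inf {ennreal \<epsilon> | \<epsilon>. 0 \<le> \<epsilon> \<and> (\<exists>\<Phi> \<Psi>. interleaving K X \<epsilon> U V \<Phi> \<Psi>)}"

definition lipschitz1_to_pmod ::
  "('k, 'm) ring_scheme \<Rightarrow> real set \<Rightarrow> 'p set \<Rightarrow> ('p \<Rightarrow> 'p \<Rightarrow> real) \<Rightarrow>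
     ('p \<Rightarrow> (real, 'k, 'v) diagram) \<Rightarrow> bool" where
  "lipschitz1_to_pmod K X S \<delta> F \<longleftrightarrow>
     (\<forall>w \<in> S. vect_functor K X (\<le>) (F w)) \<and>
     (\<forall>v \<in> S. \<forall>w \<in> S. interleaving_dist K X (F v) (F w) \<le> ennreal (\<delta> v w))"


section \<open>The space-time category and persistent homology\<close>

definition spacetime_le :: "real set \<Rightarrow> ('p \<Rightarrow> 'p \<Rightarrow> real) \<Rightarrow> 'p \<times> real \<Rightarrow> 'p \<times> real \<Rightarrow> bool" where
  "spacetime_le X \<delta> p q \<longleftrightarrow> snd p + \<delta> (fst p) (fst q) \<le> snd q \<or> snd q = Sup X"

text \<open>
  The parameter \<open>h\<close> converts a filtration parameter to a height: it is the identity for \<open>X = [-1, 1]\<close>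
  and \<open>cos\<close> for \<open>X = [-\<pi>, 0]\<close>.
\<close>

definition directional_PH ::
  "('k, 'm) ring_scheme \<Rightarrow> nat \<Rightarrow> nat \<Rightarrow> (real \<Rightarrow> real) \<Rightarrow> (nat \<Rightarrow> real) set \<Rightarrow>
     ((nat \<Rightarrow> real) \<times> real, 'k, (((nat \<Rightarrow> real) \<Rightarrow> nat \<Rightarrow> real) \<Rightarrow> 'k) set) diagram" where
  "directional_PH K n d h M =
     (let sub = (\<lambda>(v, \<alpha>). subtopology (Euclidean_space d) (sublevel d M v (h \<alpha>)))
      in \<lparr>obj = (\<lambda>p. homology K n (sub p)),
          mor = (\<lambda>p q. homology_incl K n (sub q))\<rparr>)"

end

theory Submission
  imports Defs
begin

text \<open>
  The Lipschitz bound is formal. If \<open>F\<close> is any functor on space-time, then for two directions \<open>v\<close>, \<open>w\<close>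
  at distance \<open>\<epsilon>\<close> there is a morphism \<open>(v, x) \<rightarrow> (w, min (x + \<epsilon>) (Sup X))\<close> for every parameter \<open>x\<close>, and
  one with the directions exchanged. The values of \<open>F\<close> on these morphisms form an \<open>\<epsilon>\<close>-interleaving of
  \<open>F(v, -)\<close> and \<open>F(w, -)\<close>: in a preorder all composites with the same end points agree, so naturality
  and the two triangle identities are instances of functoriality
  (\<open>spacetime_functor_lipschitz\<close>).

  Hence it suffices that each of the three Kan extensions is a functor on the whole of space-time. For
  a functor on a part of a preorder, the left and right extensions are functors by the universal
  properties of colimits and limits, because along \<open>p \<le> p'\<close> the index set of the colimit grows and
  that of the limit shrinks. The comparison map between the two is natural, and the image of a
  natural transformation of functors to vector spaces is again a functor, which settles the center
  extension (\<open>vect_functor_left_kan\<close>, \<open>vect_functor_right_kan\<close>, \<open>vect_functor_center_kan\<close>).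

  Two facts are specific to the situation. Space-time is transitive because chordal and geodesic
  distance satisfy the triangle inequality. The persistent homology of \<open>M\<close> is a functor on it
  (\<open>vect_functor_directional_PH\<close>) because a morphism of space-time is an inclusion of sublevel
  sets: in the chordal case by the Cauchy-Schwarz inequality, and in the geodesic case by its
  spherical refinement \<open>dot_le_cos_arccos_diff\<close>, which also gives the triangle inequality for angles.
  Functoriality of homology itself comes down to the fact that the boundary map squares to zero.
\<close>

section \<open>Linear maps and quotients\<close>

lemma linear_mapsI:
  assumes "\<And>x. x \<in> carrier V \<Longrightarrow> f x \<in> carrier W"
    and "\<And>x y. x \<in> carrier V \<Longrightarrow> y \<in> carrier V \<Longrightarrow> f (x \<oplus>\<^bsub>V\<^esub> y) = f x \<oplus>\<^bsub>W\<^esub> f y"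
    and "\<And>a x. a \<in> carrier K \<Longrightarrow> x \<in> carrier V \<Longrightarrow> f (a \<odot>\<^bsub>V\<^esub> x) = a \<odot>\<^bsub>W\<^esub> f x"
  shows "f \<in> linear_maps K V W"
  using assms by (auto simp: linear_maps_def)

lemma
  assumes "f \<in> linear_maps K V W"
  shows linear_maps_closed: "x \<in> carrier V \<Longrightarrow> f x \<in> carrier W"
    and linear_maps_add: "x \<in> carrier V \<Longrightarrow> y \<in> carrier V \<Longrightarrow> f (x \<oplus>\<^bsub>V\<^esub> y) = f x \<oplus>\<^bsub>W\<^esub> f y"
    and linear_maps_smult: "a \<in> carrier K \<Longrightarrow> x \<in> carrier V \<Longrightarrow> f (a \<odot>\<^bsub>V\<^esub> x) = a \<odot>\<^bsub>W\<^esub> f x"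
  using assms by (auto simp: linear_maps_def)

lemma linear_maps_comp:
  assumes "f \<in> linear_maps K U V" and "g \<in> linear_maps K V W"
  shows "(\<lambda>x. g (f x)) \<in> linear_maps K U W"
  by (rule linear_mapsI)
    (simp_all add: linear_maps_closed[OF assms(1)] linear_maps_closed[OF assms(2)]
      linear_maps_add[OF assms(1)] linear_maps_add[OF assms(2)]
      linear_maps_smult[OF assms(1)] linear_maps_smult[OF assms(2)])

lemma
  assumes V: "module K V" and W: "module K W" and f: "f \<in> linear_maps K V W"
  shows linear_maps_zero: "f \<zero>\<^bsub>V\<^esub> = \<zero>\<^bsub>W\<^esub>"
    and linear_maps_a_inv: "x \<in> carrier V \<Longrightarrow> f (\<ominus>\<^bsub>V\<^esub> x) = \<ominus>\<^bsub>W\<^esub> f x"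
    and linear_maps_minus: "x \<in> carrier V \<Longrightarrow> y \<in> carrier V \<Longrightarrow> f (x \<ominus>\<^bsub>V\<^esub> y) = f x \<ominus>\<^bsub>W\<^esub> f y"
proof -
  interpret V: module K V by (fact V)
  interpret W: module K W by (fact W)
  have "f \<zero>\<^bsub>V\<^esub> \<oplus>\<^bsub>W\<^esub> f \<zero>\<^bsub>V\<^esub> = f \<zero>\<^bsub>V\<^esub>"
    using linear_maps_add[OF f, of "\<zero>\<^bsub>V\<^esub>" "\<zero>\<^bsub>V\<^esub>"] by simp
  then show zero: "f \<zero>\<^bsub>V\<^esub> = \<zero>\<^bsub>W\<^esub>"
    using linear_maps_closed[OF f V.M.zero_closed] by (simp add: W.M.add.r_cancel_one)
  show inv: "f (\<ominus>\<^bsub>V\<^esub> x) = \<ominus>\<^bsub>W\<^esub> f x" if "x \<in> carrier V" for x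
  proof -
    have "f (\<ominus>\<^bsub>V\<^esub> x) \<oplus>\<^bsub>W\<^esub> f x = \<zero>\<^bsub>W\<^esub>"
      using that zero linear_maps_add[OF f, of "\<ominus>\<^bsub>V\<^esub> x" x] by (simp add: V.M.l_neg)
    with that show ?thesis
      by (simp add: W.M.minus_equality linear_maps_closed[OF f])
  qed
  show "f (x \<ominus>\<^bsub>V\<^esub> y) = f x \<ominus>\<^bsub>W\<^esub> f y" if "x \<in> carrier V" "y \<in> carrier V"
    using that by (simp add: a_minus_def linear_maps_add[OF f] inv)
qed

lemma submodule_kernel:
  assumes V: "module K V" and W: "module K W" and f: "f \<in> linear_maps K V W"
  shows "submodule {x \<in> carrier V. f x = \<zero>\<^bsub>W\<^esub>} K V"
proof -
  interpret V: module K V by (fact V)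
  interpret W: module K W by (fact W)
  show ?thesis
    by (rule V.submoduleI)
      (auto simp: linear_maps_zero[OF V W f] linear_maps_a_inv[OF V W f] linear_maps_add[OF f]
        linear_maps_smult[OF f])
qed

lemma submodule_image:
  assumes V: "module K V" and W: "module K W" and f: "f \<in> linear_maps K V W"
  shows "submodule (f ` carrier V) K W"
proof -
  interpret V: module K V by (fact V)
  interpret W: module K W by (fact W)
  show ?thesis
    by (rule W.submoduleI)
      (auto simp: linear_maps_zero[OF V W f, symmetric] linear_maps_a_inv[OF V W f, symmetric]
        linear_maps_add[OF f, symmetric] linear_maps_smult[OF f, symmetric] linear_maps_closed[OF f])
qed

lemma submodule_Inter:
  assumes V: "module K V" and "\<H> \<noteq> {}" and H: "\<And>H. H \<in> \<H> \<Longrightarrow> submodule H K V"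
  shows "submodule (\<Inter>\<H>) K V"
proof -
  interpret V: module K V by (fact V)
  have zero: "\<zero>\<^bsub>V\<^esub> \<in> H" if "H \<in> \<H>" for H
    using submodule.axioms(1)[OF H[OF that]] subgroup.one_closed by fastforce
  show ?thesis
    using assms(2) V.submoduleE(1)[OF H]
    by (intro V.submoduleI) (auto simp: zero V.submoduleE(3,4,5)[OF H])
qed

lemma submodule_mspan:
  assumes V: "module K V" and S: "S \<subseteq> carrier V"
  shows "submodule (mspan K V S) K V"
  unfolding mspan_def
  using module.carrier_is_submodule[OF V] S by (intro submodule_Inter[OF V]) auto

lemma mspan_superset: "S \<subseteq> mspan K V S"
  by (auto simp: mspan_def)

lemma mspan_least: "submodule H K V \<Longrightarrow> S \<subseteq> H \<Longrightarrow> mspan K V S \<subseteq> H"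
  by (auto simp: mspan_def)

lemma submodule_abelian_subgroup:
  assumes V: "module K V" and H: "submodule H K V"
  shows "abelian_subgroup H V"
  using module.axioms(2)[OF V] submodule.axioms(1)[OF H]
  by (simp add: abelian_subgroupI3 additive_subgroup.intro)

lemma carrier_quotient: "carrier (quotient_module V H) = (\<lambda>x. H +>\<^bsub>V\<^esub> x) ` carrier V"
  by (auto simp: quotient_module_def A_RCOSETS_def')

lemma zero_quotient: "\<zero>\<^bsub>quotient_module V H\<^esub> = H"
  by (simp add: quotient_module_def)

lemma coset_eq_iff:
  assumes V: "module K V" and H: "submodule H K V" and "x \<in> carrier V" "y \<in> carrier V"
  shows "H +>\<^bsub>V\<^esub> x = H +>\<^bsub>V\<^esub> y \<longleftrightarrow> x \<ominus>\<^bsub>V\<^esub> y \<in> H"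
proof -
  interpret H: abelian_subgroup H V by (rule submodule_abelian_subgroup[OF V H])
  show ?thesis
    using assms(3,4) H.a_rcos_self[of x] H.a_repr_independence'[of x y] H.a_rcos_module[of y x]
    by (auto simp: a_minus_def)
qed

lemma coset_add:
  assumes V: "module K V" and H: "submodule H K V" and "x \<in> carrier V" "y \<in> carrier V"
  shows "(H +>\<^bsub>V\<^esub> x) \<oplus>\<^bsub>quotient_module V H\<^esub> (H +>\<^bsub>V\<^esub> y) = H +>\<^bsub>V\<^esub> (x \<oplus>\<^bsub>V\<^esub> y)"
  using abelian_subgroup.a_rcos_sum[OF submodule_abelian_subgroup[OF V H] assms(3,4)]
  by (simp add: quotient_module_def)

text \<open>
  The scalar multiple of a coset is a union over all its representatives. Well-definedness of scalar
  multiplication modulo \<open>H\<close> says that all members of this union coincide.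
\<close>

lemma coset_smult:
  assumes V: "module K V" and H: "submodule H K V" and a: "a \<in> carrier K" and x: "x \<in> carrier V"
  shows "a \<odot>\<^bsub>quotient_module V H\<^esub> (H +>\<^bsub>V\<^esub> x) = H +>\<^bsub>V\<^esub> (a \<odot>\<^bsub>V\<^esub> x)"
proof -
  interpret V: module K V by (fact V)
  interpret H: abelian_subgroup H V by (rule submodule_abelian_subgroup[OF V H])
  have const: "H +>\<^bsub>V\<^esub> (a \<odot>\<^bsub>V\<^esub> y) = H +>\<^bsub>V\<^esub> (a \<odot>\<^bsub>V\<^esub> x)" if y: "y \<in> H +>\<^bsub>V\<^esub> x" for y
  proof -
    have yV: "y \<in> carrier V"
      by (rule H.a_elemrcos_carrier[OF x y])
    have "y \<ominus>\<^bsub>V\<^esub> x \<in> H"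
      using y yV x H.a_rcos_module[of x y] by (simp add: a_minus_def)
    moreover have "a \<odot>\<^bsub>V\<^esub> y \<ominus>\<^bsub>V\<^esub> a \<odot>\<^bsub>V\<^esub> x = a \<odot>\<^bsub>V\<^esub> (y \<ominus>\<^bsub>V\<^esub> x)"
      using a x yV by (simp add: a_minus_def V.smult_r_distr V.smult_r_minus)
    ultimately show ?thesis
      using a x yV V.submoduleE(4)[OF H] by (simp add: coset_eq_iff[OF V H])
  qed
  have "(\<Union>y \<in> H +>\<^bsub>V\<^esub> x. H +>\<^bsub>V\<^esub> (a \<odot>\<^bsub>V\<^esub> y)) = (\<Union>y \<in> H +>\<^bsub>V\<^esub> x. H +>\<^bsub>V\<^esub> (a \<odot>\<^bsub>V\<^esub> x))"
    by (rule SUP_cong[OF refl const])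
  also have "\<dots> = H +>\<^bsub>V\<^esub> (a \<odot>\<^bsub>V\<^esub> x)"
    using H.a_rcos_self[OF x] by blast
  finally show ?thesis
    by (simp add: quotient_module_def)
qed

lemma module_quotient:
  assumes V: "module K V" and H: "submodule H K V"
  shows "module K (quotient_module V H)"
proof -
  interpret V: module K V by (fact V)
  interpret H: abelian_subgroup H V by (rule submodule_abelian_subgroup[OF V H])
  have zero: "\<zero>\<^bsub>quotient_module V H\<^esub> = H +>\<^bsub>V\<^esub> \<zero>\<^bsub>V\<^esub>"
    using V.M.a_coset_add_zero[OF H.a_subset] by (simp add: zero_quotient)
  note cosets = carrier_quotient zero coset_add[OF V H] coset_smult[OF V H]
  show ?thesis
  proof (rule moduleI)
    show "abelian_group (quotient_module V H)"
    proof (rule abelian_groupI)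
      show "\<exists>y\<in>carrier (quotient_module V H). y \<oplus>\<^bsub>quotient_module V H\<^esub> x = \<zero>\<^bsub>quotient_module V H\<^esub>"
        if "x \<in> carrier (quotient_module V H)" for x
      proof -
        from that obtain v where v: "v \<in> carrier V" "x = H +>\<^bsub>V\<^esub> v" by (auto simp: carrier_quotient)
        then have "(H +>\<^bsub>V\<^esub> (\<ominus>\<^bsub>V\<^esub> v)) \<oplus>\<^bsub>quotient_module V H\<^esub> x = \<zero>\<^bsub>quotient_module V H\<^esub>"
          by (simp add: cosets V.M.l_neg)
        with v show ?thesis by (auto simp: carrier_quotient)
      qed
    qed (auto simp: cosets V.M.a_ac)
  qed (auto simp: cosets V.smult_l_distr V.smult_r_distr V.smult_assoc1 V.R.cring_axioms)
qed

lemma linear_maps_coset: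
  assumes V: "module K V" and H: "submodule H K V"
  shows "(\<lambda>x. H +>\<^bsub>V\<^esub> x) \<in> linear_maps K V (quotient_module V H)"
  by (rule linear_mapsI) (auto simp: carrier_quotient coset_add[OF V H] coset_smult[OF V H])


section \<open>Products, direct sums, limits and colimits\<close>

lemma module_product:
  assumes K: "cring K" and F: "\<And>j. j \<in> J \<Longrightarrow> module K (obj F j)"
  shows "module K (product_module J F)"
proof -
  have ab: "abelian_group (obj F j)" if "j \<in> J" for j
    using F[OF that] by (rule module.axioms(2))
  note am = ab[THEN abelian_group.axioms(1)]
  show ?thesis
  proof (rule moduleI[OF K])
    show "abelian_group (product_module J F)"
    proof (rule abelian_groupI)
      fix x assume x: "x \<in> carrier (product_module J F)"
      then show "\<exists>y\<in>carrier (product_module J F).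
          y \<oplus>\<^bsub>product_module J F\<^esub> x = \<zero>\<^bsub>product_module J F\<^esub>"
        by (intro bexI[of _ "\<lambda>j\<in>J. \<ominus>\<^bsub>obj F j\<^esub> x j"])
          (auto simp: product_module_def PiE_iff abelian_group.l_neg[OF ab]
            abelian_group.a_inv_closed[OF ab])
    qed (auto simp: product_module_def PiE_iff fun_eq_iff extensional_def
        abelian_monoid.zero_closed[OF am] abelian_monoid.a_closed[OF am]
        abelian_monoid.l_zero[OF am] abelian_monoid.a_assoc[OF am]
        intro: abelian_monoid.a_comm[OF am])
  qed (auto simp: product_module_def PiE_iff fun_eq_iff extensional_def module.smult_closed[OF F]
      module.smult_l_distr[OF F] module.smult_r_distr[OF F] module.smult_assoc1[OF F]
      module.smult_one[OF F])
qed

lemma product_sel: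
  "carrier (product_module J F) = (\<Pi>\<^sub>E j\<in>J. carrier (obj F j))"
  "\<zero>\<^bsub>product_module J F\<^esub> = (\<lambda>j\<in>J. \<zero>\<^bsub>obj F j\<^esub>)"
  "x \<oplus>\<^bsub>product_module J F\<^esub> y = (\<lambda>j\<in>J. x j \<oplus>\<^bsub>obj F j\<^esub> y j)"
  "a \<odot>\<^bsub>product_module J F\<^esub> x = (\<lambda>j\<in>J. a \<odot>\<^bsub>obj F j\<^esub> x j)"
  by (simp_all add: product_module_def)

lemma a_inv_product:
  assumes K: "cring K" and F: "\<And>j. j \<in> J \<Longrightarrow> module K (obj F j)"
    and x: "x \<in> carrier (product_module J F)"
  shows "\<ominus>\<^bsub>product_module J F\<^esub> x = (\<lambda>j\<in>J. \<ominus>\<^bsub>obj F j\<^esub> x j)"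
proof -
  interpret P: module K "product_module J F" by (rule module_product[OF K F])
  note ab = F[THEN module.axioms(2)]
  show ?thesis
    using x by (intro P.M.minus_equality)
      (auto simp: product_sel PiE_iff abelian_group.l_neg[OF ab]
            abelian_group.a_inv_closed[OF ab])
qed

lemma module_direct_sum:
  assumes K: "cring K" and F: "\<And>j. j \<in> J \<Longrightarrow> module K (obj F j)"
  shows "module K (direct_sum J F)"
proof -
  interpret P: module K "product_module J F" by (rule module_product[OF K F])
  note ab = F[THEN module.axioms(2)]
  note am = ab[THEN abelian_group.axioms(1)]
  let ?D = "{x \<in> carrier (product_module J F). finite {j \<in> J. x j \<noteq> \<zero>\<^bsub>obj F j\<^esub>}}"
  have "submodule ?D K (product_module J F)"
  proof (rule P.submoduleI)
    show "\<ominus>\<^bsub>product_module J F\<^esub> x \<in> ?D" if "x \<in> ?D" for x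
    proof -
      have "{j \<in> J. (\<ominus>\<^bsub>product_module J F\<^esub> x) j \<noteq> \<zero>\<^bsub>obj F j\<^esub>} \<subseteq> {j \<in> J. x j \<noteq> \<zero>\<^bsub>obj F j\<^esub>}"
        using that abelian_group.minus_equality[OF ab]
          abelian_monoid.l_zero[OF am abelian_monoid.zero_closed[OF am]] abelian_monoid.zero_closed[OF am]
        by (auto simp: a_inv_product[OF K F])
      with that show ?thesis by (auto intro: finite_subset)
    qed
    show "x \<oplus>\<^bsub>product_module J F\<^esub> y \<in> ?D" if "x \<in> ?D" "y \<in> ?D" for x y
    proof -
      have "{j \<in> J. (x \<oplus>\<^bsub>product_module J F\<^esub> y) j \<noteq> \<zero>\<^bsub>obj F j\<^esub>}
          \<subseteq> {j \<in> J. x j \<noteq> \<zero>\<^bsub>obj F j\<^esub>} \<union> {j \<in> J. y j \<noteq> \<zero>\<^bsub>obj F j\<^esub>}"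
        using abelian_monoid.l_zero[OF am abelian_monoid.zero_closed[OF am]]
        by (auto simp: product_sel)
      then have "finite {j \<in> J. (x \<oplus>\<^bsub>product_module J F\<^esub> y) j \<noteq> \<zero>\<^bsub>obj F j\<^esub>}"
        by (rule finite_subset) (use that in auto)
      with that show ?thesis by auto
    qed
    show "a \<odot>\<^bsub>product_module J F\<^esub> x \<in> ?D" if "a \<in> carrier K" "x \<in> ?D" for a x
    proof -
      have "{j \<in> J. (a \<odot>\<^bsub>product_module J F\<^esub> x) j \<noteq> \<zero>\<^bsub>obj F j\<^esub>} \<subseteq> {j \<in> J. x j \<noteq> \<zero>\<^bsub>obj F j\<^esub>}"
        using that module.smult_r_null[OF F] by (auto simp: product_sel)
      with that show ?thesis by (auto intro: finite_subset)
    qed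
  qed (auto simp: product_sel abelian_monoid.zero_closed[OF am])
  then show ?thesis
    unfolding direct_sum_def by (rule submodule.submodule_is_module) (rule P.module_axioms)
qed

lemma direct_sum_sel:
  "carrier (direct_sum J F) =
     {x \<in> (\<Pi>\<^sub>E j\<in>J. carrier (obj F j)). finite {j \<in> J. x j \<noteq> \<zero>\<^bsub>obj F j\<^esub>}}"
  "\<zero>\<^bsub>direct_sum J F\<^esub> = (\<lambda>j\<in>J. \<zero>\<^bsub>obj F j\<^esub>)"
  "x \<oplus>\<^bsub>direct_sum J F\<^esub> y = (\<lambda>j\<in>J. x j \<oplus>\<^bsub>obj F j\<^esub> y j)"
  "a \<odot>\<^bsub>direct_sum J F\<^esub> x = (\<lambda>j\<in>J. a \<odot>\<^bsub>obj F j\<^esub> x j)"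
  by (simp_all add: direct_sum_def product_module_def)

lemma linear_direct_sum_in:
  assumes F: "\<And>j. j \<in> J \<Longrightarrow> module K (obj F j)" and i: "i \<in> J"
  shows "direct_sum_in J F i \<in> linear_maps K (obj F i) (direct_sum J F)"
proof -
  note ab = F[THEN module.axioms(2)]
  note am = ab[THEN abelian_group.axioms(1)]
  have fin: "finite {j \<in> J. direct_sum_in J F i x j \<noteq> \<zero>\<^bsub>obj F j\<^esub>}" for x
    by (rule finite_subset[of _ "{i}"]) (auto simp: direct_sum_in_def)
  then have "direct_sum_in J F i x \<in> carrier (direct_sum J F)" if "x \<in> carrier (obj F i)" for x
    using that by (auto simp: direct_sum_sel direct_sum_in_def abelian_monoid.zero_closed[OF am])
  then show ?thesis
    by (rule linear_mapsI)
      (auto simp: direct_sum_sel direct_sum_in_def fun_eq_iff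
        abelian_monoid.zero_closed[OF am] abelian_monoid.l_zero[OF am] module.smult_r_null[OF F])
qed

text \<open>
  A direct sum is spanned by its summands. The proof peels one entry at a time off a finitely supported
  family. This is the uniqueness half of the universal property.
\<close>

lemma direct_sum_ext:
  assumes K: "cring K" and F: "\<And>j. j \<in> J \<Longrightarrow> module K (obj F j)"
    and f: "f \<in> linear_maps K (direct_sum J F) W" and g: "g \<in> linear_maps K (direct_sum J F) W"
    and W: "module K W"
    and eq: "\<And>i x. i \<in> J \<Longrightarrow> x \<in> carrier (obj F i) \<Longrightarrow> f (direct_sum_in J F i x) = g (direct_sum_in J F i x)"
    and x: "x \<in> carrier (direct_sum J F)"
  shows "f x = g x"
proof -
  note D = module_direct_sum[OF K F]
  note ab = F[THEN module.axioms(2)]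
  note am = ab[THEN abelian_group.axioms(1)]
  have "f x = g x" if "finite S" "x \<in> carrier (direct_sum J F)" "{j \<in> J. x j \<noteq> \<zero>\<^bsub>obj F j\<^esub>} \<subseteq> S" for S x
    using that
  proof (induction S arbitrary: x)
    case empty
    then have "x = \<zero>\<^bsub>direct_sum J F\<^esub>"
      by (auto simp: direct_sum_sel fun_eq_iff PiE_iff extensional_def)
    then show ?case
      using linear_maps_zero[OF D W f] linear_maps_zero[OF D W g] by simp
  next
    case (insert i S)
    show ?case
    proof (cases "i \<in> J")
      case False
      with insert show ?thesis by blast
    next
      case True
      define x' where "x' = (\<lambda>j\<in>J. if j = i then \<zero>\<^bsub>obj F j\<^esub> else x j)"
      have "{j \<in> J. x' j \<noteq> \<zero>\<^bsub>obj F j\<^esub>} \<subseteq> {j \<in> J. x j \<noteq> \<zero>\<^bsub>obj F j\<^esub>}"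
        by (auto simp: x'_def)
      then have "finite {j \<in> J. x' j \<noteq> \<zero>\<^bsub>obj F j\<^esub>}"
        by (rule finite_subset) (use insert.prems(1) in \<open>simp add: direct_sum_sel\<close>)
      then have x': "x' \<in> carrier (direct_sum J F)"
        using insert.prems(1) abelian_monoid.zero_closed[OF am]
        by (auto simp: direct_sum_sel x'_def PiE_iff)
      have xi: "x i \<in> carrier (obj F i)"
        using insert.prems(1) True by (auto simp: direct_sum_sel)
      have split: "x = x' \<oplus>\<^bsub>direct_sum J F\<^esub> direct_sum_in J F i (x i)"
        using insert.prems(1)
        by (auto simp: direct_sum_sel x'_def direct_sum_in_def fun_eq_iff PiE_iff extensional_def
            abelian_monoid.l_zero[OF am] abelian_monoid.r_zero[OF am])
      have "f x' = g x'"
        using insert.prems(2) by (intro insert.IH[OF x']) (auto simp: x'_def)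
      moreover have "direct_sum_in J F i (x i) \<in> carrier (direct_sum J F)"
        using linear_maps_closed[OF linear_direct_sum_in[OF F True] xi] .
      ultimately show ?thesis
        using linear_maps_add[OF f x'] linear_maps_add[OF g x'] eq[OF True xi] split by metis
    qed
  qed
  with x show ?thesis by (auto simp: direct_sum_sel)
qed

text \<open>
  The map out of the direct sum that a family of maps \<open>\<psi>\<close> out of the summands induces; passing to the
  quotient, it becomes \<open>colim_desc\<close>.
\<close>

definition direct_sum_desc where
  "direct_sum_desc J F W \<psi> x = (\<Oplus>\<^bsub>W\<^esub>j \<in> {j \<in> J. x j \<noteq> \<zero>\<^bsub>obj F j\<^esub>}. \<psi> j (x j))"

lemma
  assumes F: "\<And>j. j \<in> J \<Longrightarrow> module K (obj F j)" and W: "module K W"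
    and \<psi>: "\<And>j. j \<in> J \<Longrightarrow> \<psi> j \<in> linear_maps K (obj F j) W"
  shows linear_direct_sum_desc: "direct_sum_desc J F W \<psi> \<in> linear_maps K (direct_sum J F) W"
    and direct_sum_desc_in: "i \<in> J \<Longrightarrow> x \<in> carrier (obj F i) \<Longrightarrow>
      direct_sum_desc J F W \<psi> (direct_sum_in J F i x) = \<psi> i x"
proof -
  interpret W: module K W by (rule W)
  note ab = F[THEN module.axioms(2)]
  note am = ab[THEN abelian_group.axioms(1)]
  note zero = linear_maps_zero[OF F W \<psi>]
  \<comment> \<open>The index set of the sum depends on the argument; enlarging it to a common finite set is what
    makes sums for different arguments comparable.\<close>
  have superset: "direct_sum_desc J F W \<psi> x = (\<Oplus>\<^bsub>W\<^esub>j\<in>S. \<psi> j (x j))"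
    if x: "\<And>j. j \<in> J \<Longrightarrow> x j \<in> carrier (obj F j)"
      and S: "finite S" "S \<subseteq> J" "{j \<in> J. x j \<noteq> \<zero>\<^bsub>obj F j\<^esub>} \<subseteq> S" for x S
    unfolding direct_sum_desc_def
  proof (rule W.M.add.finprod_mono_neutral_cong_left[OF S(1,3)])
    show "(\<lambda>j. \<psi> j (x j)) \<in> S \<rightarrow> carrier W"
      using x S(2) linear_maps_closed[OF \<psi>] by blast
    show "\<psi> j (x j) = \<zero>\<^bsub>W\<^esub>" if "j \<in> S - {j \<in> J. x j \<noteq> \<zero>\<^bsub>obj F j\<^esub>}" for j
      using that S(2) zero by auto
  qed simp
  show "direct_sum_desc J F W \<psi> \<in> linear_maps K (direct_sum J F) W"
  proof (rule linear_mapsI)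
    fix x assume "x \<in> carrier (direct_sum J F)"
    then show "direct_sum_desc J F W \<psi> x \<in> carrier W"
      unfolding direct_sum_desc_def
      by (intro W.M.finsum_closed) (auto simp: direct_sum_sel PiE_iff linear_maps_closed[OF \<psi>])
  next
    fix x y assume x: "x \<in> carrier (direct_sum J F)" and y: "y \<in> carrier (direct_sum J F)"
    let ?S = "{j \<in> J. x j \<noteq> \<zero>\<^bsub>obj F j\<^esub>} \<union> {j \<in> J. y j \<noteq> \<zero>\<^bsub>obj F j\<^esub>}"
    have xy: "x j \<in> carrier (obj F j)" "y j \<in> carrier (obj F j)" if "j \<in> J" for j
      using x y that by (auto simp: direct_sum_sel)
    have fin: "finite ?S" using x y by (simp add: direct_sum_sel)
    have "direct_sum_desc J F W \<psi> (x \<oplus>\<^bsub>direct_sum J F\<^esub> y)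
        = (\<Oplus>\<^bsub>W\<^esub>j\<in>?S. \<psi> j ((x \<oplus>\<^bsub>direct_sum J F\<^esub> y) j))"
      by (rule superset[OF _ fin])
        (auto simp: direct_sum_sel xy abelian_monoid.a_closed[OF am] abelian_monoid.l_zero[OF am]
          abelian_monoid.zero_closed[OF am])
    also have "\<dots> = (\<Oplus>\<^bsub>W\<^esub>j\<in>?S. \<psi> j (x j) \<oplus>\<^bsub>W\<^esub> \<psi> j (y j))"
      by (rule W.M.finsum_cong')
        (auto simp: direct_sum_sel xy linear_maps_add[OF \<psi>] linear_maps_closed[OF \<psi>])
    also have "\<dots> = (\<Oplus>\<^bsub>W\<^esub>j\<in>?S. \<psi> j (x j)) \<oplus>\<^bsub>W\<^esub> (\<Oplus>\<^bsub>W\<^esub>j\<in>?S. \<psi> j (y j))"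
      by (rule W.M.finsum_addf) (auto simp: xy linear_maps_closed[OF \<psi>])
    also have "\<dots> = direct_sum_desc J F W \<psi> x \<oplus>\<^bsub>W\<^esub> direct_sum_desc J F W \<psi> y"
      by (subst (1 2) superset[OF _ fin]) (auto simp: xy)
    finally show "direct_sum_desc J F W \<psi> (x \<oplus>\<^bsub>direct_sum J F\<^esub> y)
        = direct_sum_desc J F W \<psi> x \<oplus>\<^bsub>W\<^esub> direct_sum_desc J F W \<psi> y" .
  next
    fix a x assume a: "a \<in> carrier K" and x: "x \<in> carrier (direct_sum J F)"
    let ?S = "{j \<in> J. x j \<noteq> \<zero>\<^bsub>obj F j\<^esub>}"
    have xj: "x j \<in> carrier (obj F j)" if "j \<in> J" for j
      using x that by (auto simp: direct_sum_sel)
    have fin: "finite ?S" using x by (simp add: direct_sum_sel)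
    have "direct_sum_desc J F W \<psi> (a \<odot>\<^bsub>direct_sum J F\<^esub> x)
        = (\<Oplus>\<^bsub>W\<^esub>j\<in>?S. \<psi> j ((a \<odot>\<^bsub>direct_sum J F\<^esub> x) j))"
      by (rule superset[OF _ fin])
        (auto simp: direct_sum_sel xj a module.smult_closed[OF F] module.smult_r_null[OF F])
    also have "\<dots> = (\<Oplus>\<^bsub>W\<^esub>j\<in>?S. a \<odot>\<^bsub>W\<^esub> \<psi> j (x j))"
      by (rule W.M.finsum_cong')
        (auto simp: direct_sum_sel xj a linear_maps_smult[OF \<psi>] linear_maps_closed[OF \<psi>])
    also have "\<dots> = a \<odot>\<^bsub>W\<^esub> direct_sum_desc J F W \<psi> x"
      unfolding direct_sum_desc_def
      by (rule W.finsum_smult_ldistr[OF fin a, symmetric]) (auto simp: xj linear_maps_closed[OF \<psi>])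
    finally show "direct_sum_desc J F W \<psi> (a \<odot>\<^bsub>direct_sum J F\<^esub> x) = a \<odot>\<^bsub>W\<^esub> direct_sum_desc J F W \<psi> x" .
  qed
  show "direct_sum_desc J F W \<psi> (direct_sum_in J F i x) = \<psi> i x"
    if i: "i \<in> J" and x: "x \<in> carrier (obj F i)"
  proof -
    have "direct_sum_desc J F W \<psi> (direct_sum_in J F i x)
        = (\<Oplus>\<^bsub>W\<^esub>j\<in>{i}. \<psi> j (direct_sum_in J F i x j))"
      using i x by (intro superset) (auto simp: direct_sum_in_def abelian_monoid.zero_closed[OF am])
    also have "\<dots> = \<psi> i x"
      using i x linear_maps_closed[OF \<psi>[OF i]] by (simp add: direct_sum_in_def)
    finally show ?thesis .
  qed
qed

definition cocone where
  "cocone K J r F W \<psi> \<longleftrightarrow>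
     (\<forall>j\<in>J. \<psi> j \<in> linear_maps K (obj F j) W) \<and>
     (\<forall>i\<in>J. \<forall>j\<in>J. r i j \<longrightarrow> (\<forall>x\<in>carrier (obj F i). \<psi> j (mor F i j x) = \<psi> i x))"

lemma vect_functorD:
  assumes "vect_functor K P r F"
  shows "p \<in> P \<Longrightarrow> module K (obj F p)"
    and "p \<in> P \<Longrightarrow> q \<in> P \<Longrightarrow> r p q \<Longrightarrow> mor F p q \<in> linear_maps K (obj F p) (obj F q)"
    and "p \<in> P \<Longrightarrow> x \<in> carrier (obj F p) \<Longrightarrow> mor F p p x = x"
    and "p \<in> P \<Longrightarrow> q \<in> P \<Longrightarrow> s \<in> P \<Longrightarrow> r p q \<Longrightarrow> r q s \<Longrightarrow> x \<in> carrier (obj F p) \<Longrightarrow>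
      mor F q s (mor F p q x) = mor F p s x"
  using assms unfolding vect_functor_def by blast+

lemma vect_functor_subset: "vect_functor K P r F \<Longrightarrow> Q \<subseteq> P \<Longrightarrow> vect_functor K Q r F"
  unfolding vect_functor_def subset_iff by blast

locale colimit =
  fixes K :: "('k, 'm) ring_scheme" and J :: "'o set" and r F
  assumes K: "cring K" and F: "vect_functor K J r F"
begin

lemma F_module: "j \<in> J \<Longrightarrow> module K (obj F j)"
  using vect_functorD(1)[OF F] .

lemmas D_module = module_direct_sum[OF K F_module]

lemma submodule_rel: "submodule (colim_rel K J r F) K (direct_sum J F)"
  unfolding colim_rel_def
proof (rule submodule_mspan[OF D_module])
  interpret D: module K "direct_sum J F" by (rule D_module)
  show "{direct_sum_in J F i x \<ominus>\<^bsub>direct_sum J F\<^esub> direct_sum_in J F j (mor F i j x) |i j x.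
          i \<in> J \<and> j \<in> J \<and> r i j \<and> x \<in> carrier (obj F i)} \<subseteq> carrier (direct_sum J F)"
    using linear_maps_closed[OF linear_direct_sum_in[OF F_module]]
      linear_maps_closed[OF vect_functorD(2)[OF F]]
    by (auto intro!: D.M.minus_closed)
qed

lemma module_colim: "module K (colim_module K J r F)"
  unfolding colim_module_def by (rule module_quotient[OF D_module submodule_rel])

lemma linear_proj: "(\<lambda>x. colim_rel K J r F +>\<^bsub>direct_sum J F\<^esub> x) \<in> linear_maps K (direct_sum J F) (colim_module K J r F)"
  unfolding colim_module_def by (rule linear_maps_coset[OF D_module submodule_rel])

lemma cocone_colim_in: "cocone K J r F (colim_module K J r F) (colim_in K J r F)"
  unfolding cocone_def
proof (intro conjI ballI impI)
  fix j assume "j \<in> J"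
  then show "colim_in K J r F j \<in> linear_maps K (obj F j) (colim_module K J r F)"
    using linear_maps_comp[OF linear_direct_sum_in[OF F_module] linear_proj]
    by (simp add: colim_in_def[abs_def])
next
  fix i j x assume *: "i \<in> J" "j \<in> J" "r i j" "x \<in> carrier (obj F i)"
  then have "direct_sum_in J F i x \<ominus>\<^bsub>direct_sum J F\<^esub> direct_sum_in J F j (mor F i j x) \<in> colim_rel K J r F"
    unfolding colim_rel_def using mspan_superset by fast
  with * show "colim_in K J r F j (mor F i j x) = colim_in K J r F i x"
    unfolding colim_in_def
    by (subst eq_commute, subst coset_eq_iff[OF D_module submodule_rel])
      (auto intro!: linear_maps_closed[OF linear_direct_sum_in[OF F_module]]
        linear_maps_closed[OF vect_functorD(2)[OF F]])
qed

text \<open>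
  Maps out of a colimit are determined by the legs of the universal cocone. All equations between
  maps out of left Kan extensions are proved by this.
\<close>

lemma colim_ext:
  assumes f: "f \<in> linear_maps K (colim_module K J r F) W"
    and g: "g \<in> linear_maps K (colim_module K J r F) W"
    and W: "module K W"
    and eq: "\<And>i x. i \<in> J \<Longrightarrow> x \<in> carrier (obj F i) \<Longrightarrow> f (colim_in K J r F i x) = g (colim_in K J r F i x)"
    and C: "C \<in> carrier (colim_module K J r F)"
  shows "f C = g C"
proof -
  obtain x where x: "x \<in> carrier (direct_sum J F)" and Cx: "C = colim_rel K J r F +>\<^bsub>direct_sum J F\<^esub> x"
    using C by (auto simp: colim_module_def carrier_quotient)
  show ?thesis
    unfolding Cx
    using direct_sum_ext[OF K F_module linear_maps_comp[OF linear_proj f]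
        linear_maps_comp[OF linear_proj g] W _ x] eq
    by (simp add: colim_in_def)
qed

context
  fixes W \<psi>
  assumes W: "module K W" and \<psi>: "cocone K J r F W \<psi>"
begin

text \<open>
  The cocone condition says exactly that the generators of \<open>colim_rel\<close> lie in the kernel of
  \<open>direct_sum_desc\<close>, so that map is constant on cosets and \<open>the_elem\<close> picks its only value.
\<close>

lemma colim_desc_coset:
  assumes x: "x \<in> carrier (direct_sum J F)"
  shows "colim_desc J F W \<psi> (colim_rel K J r F +>\<^bsub>direct_sum J F\<^esub> x) = direct_sum_desc J F W \<psi> x"
proof -
  interpret D: module K "direct_sum J F" by (rule D_module)
  interpret W: module K W by (rule W)
  interpret R: abelian_subgroup "colim_rel K J r F" "direct_sum J F"
    by (rule submodule_abelian_subgroup[OF D_module submodule_rel])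
  have \<psi>_lin: "\<psi> j \<in> linear_maps K (obj F j) W" if "j \<in> J" for j
    using \<psi> that by (simp add: cocone_def)
  note lin = linear_direct_sum_desc[OF F_module W \<psi>_lin]
  note in_lin = linear_direct_sum_in[OF F_module]
  let ?ker = "{y \<in> carrier (direct_sum J F). direct_sum_desc J F W \<psi> y = \<zero>\<^bsub>W\<^esub>}"
  have gen: "direct_sum_in J F i x \<ominus>\<^bsub>direct_sum J F\<^esub> direct_sum_in J F j (mor F i j x) \<in> ?ker"
    if *: "i \<in> J" "j \<in> J" "r i j" "x \<in> carrier (obj F i)" for i j x
  proof (intro CollectI conjI)
    have mem: "mor F i j x \<in> carrier (obj F j)"
      using * linear_maps_closed[OF vect_functorD(2)[OF F]] by blast
    show "direct_sum_in J F i x \<ominus>\<^bsub>direct_sum J F\<^esub> direct_sum_in J F j (mor F i j x) \<in> carrier (direct_sum J F)"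
      using * mem by (intro D.M.minus_closed linear_maps_closed[OF in_lin])
    show "direct_sum_desc J F W \<psi> (direct_sum_in J F i x \<ominus>\<^bsub>direct_sum J F\<^esub> direct_sum_in J F j (mor F i j x)) = \<zero>\<^bsub>W\<^esub>"
      using * mem \<psi> linear_maps_closed[OF \<psi>_lin]
      by (simp add: linear_maps_minus[OF D_module W lin] linear_maps_closed[OF in_lin]
          direct_sum_desc_in[OF F_module W \<psi>_lin] cocone_def W.M.minus_eq W.M.r_neg)
  qed
  have "colim_rel K J r F \<subseteq> ?ker"
    unfolding colim_rel_def
    by (rule mspan_least[OF submodule_kernel[OF D_module W lin]]) (use gen in blast)+
  then have "direct_sum_desc J F W \<psi> y = direct_sum_desc J F W \<psi> x"
    if "y \<in> colim_rel K J r F +>\<^bsub>direct_sum J F\<^esub> x" for y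
    using that x linear_maps_closed[OF lin x]
    by (auto simp: a_r_coset_def' linear_maps_add[OF lin])
  then have "direct_sum_desc J F W \<psi> ` (colim_rel K J r F +>\<^bsub>direct_sum J F\<^esub> x) = {direct_sum_desc J F W \<psi> x}"
    using R.a_rcos_self[OF x] by blast
  then show ?thesis
    unfolding colim_desc_def direct_sum_desc_def[abs_def] by simp
qed

lemma linear_colim_desc: "colim_desc J F W \<psi> \<in> linear_maps K (colim_module K J r F) W"
proof -
  interpret D: module K "direct_sum J F" by (rule D_module)
  have lin: "direct_sum_desc J F W \<psi> \<in> linear_maps K (direct_sum J F) W"
    using \<psi> by (intro linear_direct_sum_desc[OF F_module W]) (auto simp: cocone_def)
  show ?thesis
    by (rule linear_mapsI)
      (auto simp: colim_module_def carrier_quotient coset_add[OF D_module submodule_rel]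
        coset_smult[OF D_module submodule_rel] colim_desc_coset linear_maps_closed[OF lin]
        linear_maps_add[OF lin] linear_maps_smult[OF lin])
qed

lemma colim_desc_in:
  assumes "i \<in> J" and "x \<in> carrier (obj F i)"
  shows "colim_desc J F W \<psi> (colim_in K J r F i x) = \<psi> i x"
  using assms \<psi> linear_maps_closed[OF linear_direct_sum_in[OF F_module]]
  by (simp add: colim_in_def colim_desc_coset direct_sum_desc_in[OF F_module W] cocone_def)

end

end

lemma module_lim:
  assumes K: "cring K" and F: "vect_functor K J r F"
  shows "module K (lim_module J r F)"
proof -
  note F_module = vect_functorD(1)[OF F] and F_lin = vect_functorD(2)[OF F]
  interpret P: module K "product_module J F" by (rule module_product[OF K F_module])
  let ?L = "{x \<in> carrier (product_module J F). \<forall>i\<in>J. \<forall>j\<in>J. r i j \<longrightarrow> mor F i j (x i) = x j}"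
  have "submodule ?L K (product_module J F)"
  proof (rule P.submoduleI)
    show "\<ominus>\<^bsub>product_module J F\<^esub> x \<in> ?L" if "x \<in> ?L" for x
      using that P.M.a_inv_closed[of x]
      by (auto simp: a_inv_product[OF K F_module] product_sel(1) PiE_iff
          linear_maps_a_inv[OF F_module F_module F_lin])
    show "\<zero>\<^bsub>product_module J F\<^esub> \<in> ?L"
      using P.M.zero_closed
      by (auto simp: product_sel(2) linear_maps_zero[OF F_module F_module F_lin])
    show "x \<oplus>\<^bsub>product_module J F\<^esub> y \<in> ?L" if "x \<in> ?L" "y \<in> ?L" for x y
      using that P.M.a_closed[of x y]
      by (auto simp: product_sel(1,3) PiE_iff linear_maps_add[OF F_lin])
    show "a \<odot>\<^bsub>product_module J F\<^esub> x \<in> ?L" if "a \<in> carrier K" "x \<in> ?L" for a x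
      using that P.smult_closed[of a x]
      by (auto simp: product_sel(1,4) PiE_iff linear_maps_smult[OF F_lin])
  qed auto
  then show ?thesis
    unfolding lim_module_def by (rule submodule.submodule_is_module) (rule P.module_axioms)
qed

lemma lim_module_sel:
  "carrier (lim_module J r F) =
     {x \<in> (\<Pi>\<^sub>E j\<in>J. carrier (obj F j)). \<forall>i\<in>J. \<forall>j\<in>J. r i j \<longrightarrow> mor F i j (x i) = x j}"
  "x \<oplus>\<^bsub>lim_module J r F\<^esub> y = (\<lambda>j\<in>J. x j \<oplus>\<^bsub>obj F j\<^esub> y j)"
  "a \<odot>\<^bsub>lim_module J r F\<^esub> x = (\<lambda>j\<in>J. a \<odot>\<^bsub>obj F j\<^esub> x j)"
  by (simp_all add: lim_module_def product_module_def)

lemma linear_lim_lift: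
  assumes "\<And>j. j \<in> J \<Longrightarrow> \<psi> j \<in> linear_maps K U (obj F j)"
    and "\<And>i j u. i \<in> J \<Longrightarrow> j \<in> J \<Longrightarrow> r i j \<Longrightarrow> u \<in> carrier U \<Longrightarrow> mor F i j (\<psi> i u) = \<psi> j u"
  shows "lim_lift J \<psi> \<in> linear_maps K U (lim_module J r F)"
  by (rule linear_mapsI)
    (auto simp: lim_lift_def lim_module_sel fun_eq_iff linear_maps_closed[OF assms(1)] assms(2)
      linear_maps_add[OF assms(1)] linear_maps_smult[OF assms(1)])


section \<open>Kan extensions are functors\<close>

lemma cocone_subset: "cocone K J r F W \<psi> \<Longrightarrow> I \<subseteq> J \<Longrightarrow> cocone K I r F W \<psi>"
  by (simp add: cocone_def subset_iff)

text \<open>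
  The functor \<open>G\<close> lives on a part \<open>Q\<close> of the preorder \<open>(P, r)\<close> and is extended to all of \<open>P\<close>.
\<close>

locale kan_extension =
  fixes K :: "('k, 'm) ring_scheme" and P Q :: "'o set" and r and G :: "('o, 'k, 'v) diagram"
  assumes K: "cring K" and QP: "Q \<subseteq> P" and G: "vect_functor K Q r G"
    and r_trans: "\<And>p q s. p \<in> P \<Longrightarrow> q \<in> P \<Longrightarrow> s \<in> P \<Longrightarrow> r p q \<Longrightarrow> r q s \<Longrightarrow> r p s"
begin

abbreviation "lower p \<equiv> {q \<in> Q. r q p}"
abbreviation "upper p \<equiv> {q \<in> Q. r p q}"
abbreviation "Lan \<equiv> left_kan K Q r G"
abbreviation "Ran \<equiv> right_kan Q r G"
abbreviation "leg p \<equiv> colim_in K (lower p) r G"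

lemma lower_mono: "p \<in> P \<Longrightarrow> p' \<in> P \<Longrightarrow> r p p' \<Longrightarrow> lower p \<subseteq> lower p'"
  using r_trans QP by blast

lemma upper_antimono: "p \<in> P \<Longrightarrow> p' \<in> P \<Longrightarrow> r p p' \<Longrightarrow> upper p' \<subseteq> upper p"
  using r_trans QP by blast

lemma G_lower: "vect_functor K (lower p) r G" and G_upper: "vect_functor K (upper p) r G"
  by (rule vect_functor_subset[OF G]; blast)+

sublocale lower: colimit K "lower p" r G for p
  by (rule colimit.intro[OF K G_lower])

lemma Lan_obj: "obj Lan p = colim_module K (lower p) r G"
  by (simp add: left_kan_def)

lemma Ran_obj: "obj Ran p = lim_module (upper p) r G"
  by (simp add: right_kan_def)

lemma module_Lan: "module K (obj Lan p)"
  by (simp add: Lan_obj lower.module_colim)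

lemma module_Ran: "module K (obj Ran p)"
  by (simp add: Ran_obj module_lim[OF K G_upper])

lemma Lan_ext:
  assumes "f \<in> linear_maps K (obj Lan p) W" and "g \<in> linear_maps K (obj Lan p) W" and "module K W"
    and "\<And>i x. i \<in> lower p \<Longrightarrow> x \<in> carrier (obj G i) \<Longrightarrow> f (leg p i x) = g (leg p i x)"
    and "u \<in> carrier (obj Lan p)"
  shows "f u = g u"
  using assms lower.colim_ext[of f p W g u] by (simp add: Lan_obj)

lemma
  assumes p: "p \<in> P" "p' \<in> P" "r p p'"
  shows linear_Lan_mor: "mor Lan p p' \<in> linear_maps K (obj Lan p) (obj Lan p')"
    and Lan_mor_leg: "i \<in> lower p \<Longrightarrow> x \<in> carrier (obj G i) \<Longrightarrow> mor Lan p p' (leg p i x) = leg p' i x"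
proof -
  have "cocone K (lower p) r G (obj Lan p') (leg p')"
    using cocone_subset[OF lower.cocone_colim_in lower_mono[OF p]] by (simp add: Lan_obj)
  note * = module_Lan this
  show "mor Lan p p' \<in> linear_maps K (obj Lan p) (obj Lan p')"
    using lower.linear_colim_desc[OF *] by (simp add: left_kan_def)
  show "mor Lan p p' (leg p i x) = leg p' i x" if "i \<in> lower p" "x \<in> carrier (obj G i)"
    using lower.colim_desc_in[OF * that] by (simp add: left_kan_def)
qed

text \<open>
  The transition maps send legs to legs, which determines them; identities and composites are then
  checked on the legs.
\<close>

theorem vect_functor_left_kan:
  assumes refl: "\<And>p. p \<in> P \<Longrightarrow> r p p"
  shows "vect_functor K P r Lan"
  unfolding vect_functor_def
proof (intro conjI ballI impI)
  fix p x assume p: "p \<in> P" and x: "x \<in> carrier (obj Lan p)"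
  have "(\<lambda>x. x) \<in> linear_maps K (obj Lan p) (obj Lan p)"
    by (simp add: linear_maps_def)
  then show "mor Lan p p x = x"
    using Lan_ext[OF linear_Lan_mor[OF p p refl[OF p]] _ module_Lan _ x] Lan_mor_leg[OF p p refl[OF p]]
    by blast
next
  fix p q s x assume *: "p \<in> P" "q \<in> P" "s \<in> P" "r p q" "r q s" and x: "x \<in> carrier (obj Lan p)"
  have ps: "r p s" using r_trans * by blast
  show "mor Lan q s (mor Lan p q x) = mor Lan p s x"
  proof (rule Lan_ext[OF linear_maps_comp[OF linear_Lan_mor linear_Lan_mor] linear_Lan_mor module_Lan _ x])
    fix i y assume i: "i \<in> lower p" and y: "y \<in> carrier (obj G i)"
    have "i \<in> lower q" using lower_mono * i by blast
    then show "mor Lan q s (mor Lan p q (leg p i y)) = mor Lan p s (leg p i y)"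
      using * ps i y by (simp add: Lan_mor_leg)
  qed (use * ps in auto)
qed (auto simp: module_Lan linear_Lan_mor)

lemma linear_Ran_mor:
  assumes p: "p \<in> P" "p' \<in> P" "r p p'"
  shows "mor Ran p p' \<in> linear_maps K (obj Ran p) (obj Ran p')"
proof -
  note sub = subsetD[OF upper_antimono[OF p]]
  have "lim_lift (upper p') (\<lambda>q x. x q) \<in> linear_maps K (lim_module (upper p) r G) (lim_module (upper p') r G)"
  proof (rule linear_lim_lift)
    show "(\<lambda>x. x j) \<in> linear_maps K (lim_module (upper p) r G) (obj G j)" if "j \<in> upper p'" for j
      using sub[OF that] by (intro linear_mapsI) (simp_all add: lim_module_sel PiE_iff)
    show "mor G i j (u i) = u j"
      if "i \<in> upper p'" "j \<in> upper p'" "r i j" "u \<in> carrier (lim_module (upper p) r G)" for i j u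
      using sub[OF that(1)] sub[OF that(2)] that(3,4) by (simp add: lim_module_sel)
  qed
  then show ?thesis by (simp add: Ran_obj right_kan_def)
qed

text \<open>
  The transition maps restrict compatible families to a smaller index set, and restriction is
  visibly functorial.
\<close>

theorem vect_functor_right_kan: "vect_functor K P r Ran"
  unfolding vect_functor_def
proof (intro conjI ballI impI)
  fix p q s x assume *: "p \<in> P" "q \<in> P" "s \<in> P" "r p q" "r q s" and x: "x \<in> carrier (obj Ran p)"
  show "mor Ran q s (mor Ran p q x) = mor Ran p s x"
    using upper_antimono[of q s] * by (auto simp: right_kan_def lim_lift_def fun_eq_iff)
next
  fix p x assume "x \<in> carrier (obj Ran p)"
  then have "x \<in> extensional (upper p)"
    by (simp add: Ran_obj lim_module_sel PiE_iff)
  then show "mor Ran p p x = x"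
    by (simp add: right_kan_def lim_lift_def extensional_restrict)
qed (simp_all add: module_Ran linear_Ran_mor)

text \<open>
  Every object below \<open>p\<close> is, by transitivity through \<open>p\<close>, below every object above \<open>p\<close>. So for each
  \<open>i\<close> below \<open>p\<close> the maps of \<open>G\<close> out of \<open>i\<close> form a cone over the objects above \<open>p\<close>, and the
  resulting maps into the limit form a cocone in \<open>i\<close>.
\<close>

lemma cocone_comparison:
  assumes p: "p \<in> P"
  shows "cocone K (lower p) r G (obj Ran p) (\<lambda>i. lim_lift (upper p) (\<lambda>j. mor G i j))"
proof -
  have between: "r i j" "i \<in> Q" "j \<in> Q" if "i \<in> lower p" "j \<in> upper p" for i j
    using that p QP r_trans[of i p j] by auto
  have "lim_lift (upper p) (\<lambda>j. mor G i j) \<in> linear_maps K (obj G i) (lim_module (upper p) r G)"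
    if i: "i \<in> lower p" for i
  proof (rule linear_lim_lift)
    show "mor G i j \<in> linear_maps K (obj G i) (obj G j)" if "j \<in> upper p" for j
      using between[OF i that] by (rule vect_functorD(2)[OF G, rotated 2])
    show "mor G j k (mor G i j u) = mor G i k u"
      if "j \<in> upper p" "k \<in> upper p" "r j k" "u \<in> carrier (obj G i)" for j k u
      using between[OF i that(1)] between[OF i that(2)] that by (intro vect_functorD(4)[OF G]) auto
  qed
  moreover have "lim_lift (upper p) (\<lambda>j. mor G i' j) (mor G i i' x) = lim_lift (upper p) (\<lambda>j. mor G i j) x"
    if "i \<in> lower p" "i' \<in> lower p" "r i i'" "x \<in> carrier (obj G i)" for i i' x
    unfolding lim_lift_def
  proof (rule restrict_ext)
    fix j assume "j \<in> upper p"
    with that show "mor G i' j (mor G i i' x) = mor G i j x"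
      using between[of i' j] by (intro vect_functorD(4)[OF G]) auto
  qed
  ultimately show ?thesis
    unfolding cocone_def Ran_obj by blast
qed

abbreviation "\<kappa> \<equiv> kan_comparison Q r G"

lemma
  assumes p: "p \<in> P"
  shows linear_comparison: "\<kappa> p \<in> linear_maps K (obj Lan p) (obj Ran p)"
    and comparison_leg: "i \<in> lower p \<Longrightarrow> x \<in> carrier (obj G i) \<Longrightarrow>
      \<kappa> p (leg p i x) = lim_lift (upper p) (\<lambda>j. mor G i j) x"
  using lower.linear_colim_desc[OF module_Ran cocone_comparison[OF p]]
    lower.colim_desc_in[OF module_Ran cocone_comparison[OF p]]
  by (simp_all add: kan_comparison_def Lan_obj)

lemma comparison_natural:
  assumes p: "p \<in> P" "p' \<in> P" "r p p'" and u: "u \<in> carrier (obj Lan p)"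
  shows "\<kappa> p' (mor Lan p p' u) = mor Ran p p' (\<kappa> p u)"
proof (rule Lan_ext[OF linear_maps_comp[OF linear_Lan_mor[OF p] linear_comparison[OF p(2)]]
      linear_maps_comp[OF linear_comparison[OF p(1)] linear_Ran_mor[OF p]] module_Ran _ u])
  fix i x assume i: "i \<in> lower p" and x: "x \<in> carrier (obj G i)"
  have i': "i \<in> lower p'" using lower_mono[OF p] i by blast
  show "\<kappa> p' (mor Lan p p' (leg p i x)) = mor Ran p p' (\<kappa> p (leg p i x))"
    unfolding Lan_mor_leg[OF p i x] comparison_leg[OF p(1) i x] comparison_leg[OF p(2) i' x]
    using upper_antimono[OF p] by (auto simp: right_kan_def lim_lift_def fun_eq_iff)
qed

text \<open>
  Naturality of the comparison map makes its image stable under the transition maps of the right Kan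
  extension, so the image is a subfunctor.
\<close>

theorem vect_functor_center_kan: "vect_functor K P r (center_kan K Q r G)"
proof -
  let ?C = "center_kan K Q r G"
  have obj: "obj ?C p = (obj Ran p)\<lparr>carrier := \<kappa> p ` carrier (obj Lan p)\<rparr>" for p
    by (simp add: center_kan_def)
  have mor: "mor ?C = mor Ran"
    by (simp add: center_kan_def)
  have sub: "submodule (\<kappa> p ` carrier (obj Lan p)) K (obj Ran p)" if "p \<in> P" for p
    by (rule submodule_image[OF module_Lan module_Ran linear_comparison[OF that]])
  have carrier: "x \<in> carrier (obj Ran p)" if "p \<in> P" "x \<in> carrier (obj ?C p)" for p x
    using that linear_maps_closed[OF linear_comparison[OF that(1)]] by (auto simp: obj)
  show ?thesis
    unfolding vect_functor_def mor
  proof (intro conjI ballI impI)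
    fix p assume p: "p \<in> P"
    show "module K (obj ?C p)"
      unfolding obj by (rule submodule.submodule_is_module[OF sub[OF p] module_Ran])
  next
    fix p q assume p: "p \<in> P" "q \<in> P" "r p q"
    show "mor Ran p q \<in> linear_maps K (obj ?C p) (obj ?C q)"
    proof (rule linear_mapsI)
      fix x assume "x \<in> carrier (obj ?C p)"
      then show "mor Ran p q x \<in> carrier (obj ?C q)"
        using linear_maps_closed[OF linear_Lan_mor[OF p]]
        by (auto simp: obj comparison_natural[OF p, symmetric])
    qed (use carrier[OF p(1)] linear_maps_add[OF linear_Ran_mor[OF p]]
        linear_maps_smult[OF linear_Ran_mor[OF p]] in \<open>auto simp: obj\<close>)
  next
    fix p x assume "p \<in> P" "x \<in> carrier (obj ?C p)"
    then show "mor Ran p p x = x"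
      by (intro vect_functorD(3)[OF vect_functor_right_kan] carrier)
  next
    fix p q s x assume *: "p \<in> P" "q \<in> P" "s \<in> P" "r p q" "r q s" "x \<in> carrier (obj ?C p)"
    show "mor Ran q s (mor Ran p q x) = mor Ran p s x"
      by (rule vect_functorD(4)[OF vect_functor_right_kan *(1-5) carrier[OF *(1,6)]])
  qed
qed

end


section \<open>Functors on space-time are Lipschitz\<close>

text \<open>
  The objects at time \<open>Sup X\<close> receive a morphism from everywhere, so the only composites at stake
  beyond the triangle inequality are those that pass through such an object; nonnegative
  distance forces them to stay at time \<open>Sup X\<close>.
\<close>

lemma spacetime_le_trans:
  assumes triangle: "\<And>u v w. u \<in> S \<Longrightarrow> v \<in> S \<Longrightarrow> w \<in> S \<Longrightarrow> \<delta> u w \<le> \<delta> u v + \<delta> v w"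
    and nonneg: "\<And>v w. v \<in> S \<Longrightarrow> w \<in> S \<Longrightarrow> 0 \<le> \<delta> v w"
    and X: "\<And>x. x \<in> X \<Longrightarrow> x \<le> Sup X"
    and mem: "p \<in> S \<times> X" "q \<in> S \<times> X" "s \<in> S \<times> X"
    and le: "spacetime_le X \<delta> p q" "spacetime_le X \<delta> q s"
  shows "spacetime_le X \<delta> p s"
proof -
  obtain u a v b w c where p: "p = (u, a)" "q = (v, b)" "s = (w, c)"
    by (metis surj_pair)
  have "u \<in> S" "v \<in> S" "w \<in> S" "c \<le> Sup X"
    using mem X by (auto simp: p)
  then show ?thesis
    using le triangle[of u v w] nonneg[of v w] by (auto simp: p spacetime_le_def)
qed

text \<open>
  The interleaving consists of the values of \<open>F\<close> on the morphisms that move from one direction to the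
  other and wait for as long as the distance requires.
\<close>

theorem spacetime_functor_lipschitz:
  assumes X: "X = {a..b}" and "a \<le> b"
    and F: "vect_functor K (S \<times> X) (spacetime_le X \<delta>) F"
    and nonneg: "\<And>v w. v \<in> S \<Longrightarrow> w \<in> S \<Longrightarrow> 0 \<le> \<delta> v w"
    and refl: "\<And>v. v \<in> S \<Longrightarrow> \<delta> v v = 0"
    and sym: "\<And>v w. v \<in> S \<Longrightarrow> w \<in> S \<Longrightarrow> \<delta> v w = \<delta> w v"
  shows "lipschitz1_to_pmod K X S \<delta> (\<lambda>w. precomp F (Pair w))"
proof -
  have Sup: "Sup X = b" using X \<open>a \<le> b\<close> by simp
  note FD = vect_functorD[OF F]
  have le: "spacetime_le X \<delta> (v, x) (v, y)" if "v \<in> S" "x \<le> y" for v x y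
    using that refl by (simp add: spacetime_le_def)
  have shift_mem: "shift X \<epsilon> x \<in> X" if "x \<in> X" "0 \<le> \<epsilon>" for \<epsilon> x
    using that X \<open>a \<le> b\<close> by (auto simp: shift_def Sup)
  have shift_mono: "shift X \<epsilon> x \<le> shift X \<epsilon> y" if "x \<le> y" for \<epsilon> x y
    using that by (auto simp: shift_def)
  have shift_twice: "shift X \<epsilon> (shift X \<epsilon> x) = shift X (2 * \<epsilon>) x" if "0 \<le> \<epsilon>" for \<epsilon> x
    using that by (auto simp: shift_def min_def)
  have to: "spacetime_le X \<delta> (v, x) (w, shift X (\<delta> v w) x)" for v w x
    by (simp add: spacetime_le_def shift_def min_def)
  define \<Phi> where "\<Phi> v w x = mor F (v, x) (w, shift X (\<delta> v w) x)" for v w x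
  have half: "nat_trans K X (\<le>) (precomp F (Pair v)) (precomp (precomp F (Pair w)) (shift X (\<delta> v w))) (\<Phi> v w)"
    if "v \<in> S" "w \<in> S" for v w
    unfolding nat_trans_def precomp_def diagram.simps \<Phi>_def
  proof (intro conjI ballI impI)
    fix p assume "p \<in> X"
    then show "mor F (v, p) (w, shift X (\<delta> v w) p)
        \<in> linear_maps K (obj F (v, p)) (obj F (w, shift X (\<delta> v w) p))"
      using that shift_mem nonneg to by (intro FD(2)) auto
  next
    fix p q x assume *: "p \<in> X" "q \<in> X" "p \<le> q" "x \<in> carrier (obj F (v, p))"
    then show "mor F (v, q) (w, shift X (\<delta> v w) q) (mor F (v, p) (v, q) x)
        = mor F (w, shift X (\<delta> v w) p) (w, shift X (\<delta> v w) q) (mor F (v, p) (w, shift X (\<delta> v w) p) x)"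
      using that shift_mem nonneg shift_mono
      by (subst (1 2) FD(4)) (auto intro: le to)
  qed
  have inter: "interleaving K X (\<delta> v w) (precomp F (Pair v)) (precomp F (Pair w)) (\<Phi> v w) (\<Phi> w v)"
    if "v \<in> S" "w \<in> S" for v w
  proof -
    \<comment> \<open>Going to \<open>w\<close> and back amounts to waiting at \<open>v\<close> for twice the distance.\<close>
    have round: "\<Phi> w v (shift X (\<delta> v w) x) (\<Phi> v w x u) = mor F (v, x) (v, shift X (2 * \<delta> v w) x) u"
      if "v \<in> S" "w \<in> S" "x \<in> X" "u \<in> carrier (obj F (v, x))" for v w x u
      unfolding \<Phi>_def sym[OF that(2,1)] shift_twice[OF nonneg[OF that(1,2)]]
    proof (rule FD(4))
      show "spacetime_le X \<delta> (w, shift X (\<delta> v w) x) (v, shift X (2 * \<delta> v w) x)"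
        using to[of w "shift X (\<delta> v w) x" v]
        unfolding sym[OF that(2,1)] shift_twice[OF nonneg[OF that(1,2)]] .
    qed (use that to shift_mem nonneg in auto)
    show ?thesis
      using half[OF that] half[OF that(2,1)] round[OF that] round[OF that(2,1)]
      by (simp add: interleaving_def precomp_def sym[OF that(2,1)])
  qed
  show ?thesis
    unfolding lipschitz1_to_pmod_def
  proof (intro conjI ballI)
    fix w assume "w \<in> S"
    then show "vect_functor K X (\<le>) (precomp F (Pair w))"
      unfolding vect_functor_def precomp_def diagram.simps
      using FD(1) FD(2)[OF _ _ le] FD(3) FD(4)[OF _ _ _ le le] by auto
  next
    fix v w assume "v \<in> S" "w \<in> S"
    then show "interleaving_dist K X (precomp F (Pair v)) (precomp F (Pair w)) \<le> ennreal (\<delta> v w)"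
      unfolding interleaving_dist_def using inter nonneg by (intro Inf_lower) blast
  qed
qed


section \<open>Homology as a functor\<close>

lemma chains_sel:
  "c \<in> carrier (chains K p X) \<longleftrightarrow> (\<forall>\<sigma>. c \<sigma> \<in> carrier K) \<and> finite {\<sigma>. c \<sigma> \<noteq> \<zero>\<^bsub>K\<^esub>} \<and>
     (\<forall>\<sigma>. c \<sigma> \<noteq> \<zero>\<^bsub>K\<^esub> \<longrightarrow> singular_simplex p X \<sigma>)"
  "\<zero>\<^bsub>chains K p X\<^esub> = (\<lambda>\<sigma>. \<zero>\<^bsub>K\<^esub>)"
  "c \<oplus>\<^bsub>chains K p X\<^esub> c' = (\<lambda>\<sigma>. c \<sigma> \<oplus>\<^bsub>K\<^esub> c' \<sigma>)"
  "a \<odot>\<^bsub>chains K p X\<^esub> c = (\<lambda>\<sigma>. a \<otimes>\<^bsub>K\<^esub> c \<sigma>)"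
  by (simp_all add: chains_def)

lemma module_chains:
  assumes "cring K"
  shows "module K (chains K p X)"
proof -
  interpret K: cring K by fact
  \<comment> \<open>A pointwise operation that preserves zero keeps supports finite and inside the simplices of \<open>X\<close>.\<close>
  have supp: "d \<in> carrier (chains K p X)"
    if "\<And>\<sigma>. d \<sigma> \<in> carrier K" "c \<in> carrier (chains K p X)" "c' \<in> carrier (chains K p X)"
      and d: "\<And>\<sigma>. c \<sigma> = \<zero>\<^bsub>K\<^esub> \<Longrightarrow> c' \<sigma> = \<zero>\<^bsub>K\<^esub> \<Longrightarrow> d \<sigma> = \<zero>\<^bsub>K\<^esub>" for c c' d
  proof -
    have "finite ({\<sigma>. c \<sigma> \<noteq> \<zero>\<^bsub>K\<^esub>} \<union> {\<sigma>. c' \<sigma> \<noteq> \<zero>\<^bsub>K\<^esub>})"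
      using that(2,3) by (simp add: chains_sel)
    then have "finite {\<sigma>. d \<sigma> \<noteq> \<zero>\<^bsub>K\<^esub>}"
      by (rule finite_subset[rotated]) (use d in auto)
    with that show ?thesis
      unfolding chains_sel by blast
  qed
  show ?thesis
  proof (rule moduleI)
    show "abelian_group (chains K p X)"
    proof (rule abelian_groupI)
      show "c \<oplus>\<^bsub>chains K p X\<^esub> c' \<in> carrier (chains K p X)"
        if "c \<in> carrier (chains K p X)" "c' \<in> carrier (chains K p X)" for c c'
        by (rule supp[OF _ that]) (use that in \<open>auto simp: chains_sel\<close>)
      show "\<exists>c'\<in>carrier (chains K p X). c' \<oplus>\<^bsub>chains K p X\<^esub> c = \<zero>\<^bsub>chains K p X\<^esub>"
        if "c \<in> carrier (chains K p X)" for c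
      proof (rule bexI)
        show "(\<lambda>\<sigma>. \<ominus>\<^bsub>K\<^esub> c \<sigma>) \<in> carrier (chains K p X)"
          by (rule supp[OF _ that that]) (use that in \<open>auto simp: chains_sel\<close>)
      qed (use that in \<open>auto simp: chains_sel K.l_neg\<close>)
    qed (auto simp: chains_sel K.a_ac)
    show "a \<odot>\<^bsub>chains K p X\<^esub> c \<in> carrier (chains K p X)"
      if "a \<in> carrier K" "c \<in> carrier (chains K p X)" for a c
      by (rule supp[OF _ that(2) that(2)]) (use that in \<open>auto simp: chains_sel\<close>)
  qed (auto simp: chains_sel K.l_distr K.r_distr K.m_assoc K.cring_axioms)
qed

lemma (in abelian_monoid) finsum_swap:
  assumes "finite A" "finite B" "\<And>i j. i \<in> A \<Longrightarrow> j \<in> B \<Longrightarrow> f i j \<in> carrier G"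
  shows "(\<Oplus>i\<in>A. \<Oplus>j\<in>B. f i j) = (\<Oplus>j\<in>B. \<Oplus>i\<in>A. f i j)"
  using assms(1,3)
proof (induction A)
  case empty
  then show ?case by (simp add: finsum_zero)
next
  case (insert i A)
  have "(\<Oplus>j\<in>B. \<Oplus>i\<in>insert i A. f i j) = (\<Oplus>j\<in>B. f i j \<oplus> (\<Oplus>i\<in>A. f i j))"
    using insert by (intro finsum_cong') auto
  also have "\<dots> = (\<Oplus>j\<in>B. f i j) \<oplus> (\<Oplus>j\<in>B. \<Oplus>i\<in>A. f i j)"
    using insert by (intro finsum_addf) auto
  finally show ?case
    using insert by simp
qed

lemma add_pow_int_0: "add_pow R (0 :: int) x = \<zero>\<^bsub>R\<^esub>"
  by (simp add: add_pow_def)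

lemma (in abelian_group) finsum_add_pow_int:
  fixes k :: "'t \<Rightarrow> int"
  assumes "finite T" "x \<in> carrier G"
  shows "(\<Oplus>t\<in>T. [k t] \<cdot> x) = [(\<Sum>t\<in>T. k t)] \<cdot> x"
  using assms(1)
proof (induction T)
  case empty
  then show ?case by (simp add: add_pow_int_0)
next
  case (insert t T)
  then show ?case using assms(2) by (simp add: add.int_pow_mult)
qed

lemma (in abelian_group) add_pow_int_finsum:
  assumes "finite T" "\<And>t. t \<in> T \<Longrightarrow> f t \<in> carrier G"
  shows "[(k :: int)] \<cdot> (\<Oplus>t\<in>T. f t) = (\<Oplus>t\<in>T. [k] \<cdot> f t)"
  using assms
proof (induction T)
  case empty
  then show ?case by simp
next
  case (insert t T)
  then show ?case by (simp add: add.int_pow_distrib)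
qed

abbreviation incidence :: "nat \<Rightarrow> ((nat \<Rightarrow> real) \<Rightarrow> 'a) \<Rightarrow> ((nat \<Rightarrow> real) \<Rightarrow> 'a) \<Rightarrow> int" where
  "incidence p \<sigma> \<tau> \<equiv> poly_mapping.lookup (chain_boundary p (frag_of \<sigma>)) \<tau>"

lemma lookup_chain_boundary:
  "poly_mapping.lookup (chain_boundary p c) \<rho>
     = (\<Sum>\<tau>\<in>Poly_Mapping.keys c. poly_mapping.lookup c \<tau> * incidence p \<tau> \<rho>)"
proof -
  have "chain_boundary p c = chain_boundary p (frag_extend frag_of c)"
    by (simp flip: frag_expansion)
  also have "\<dots> = (\<Sum>\<tau>\<in>Poly_Mapping.keys c.
      frag_cmul (poly_mapping.lookup c \<tau>) (chain_boundary p (frag_of \<tau>)))"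
    by (simp add: frag_extend_def chain_boundary_sum chain_boundary_cmul)
  finally show ?thesis
    by (simp add: lookup_sum)
qed

text \<open>
  The integral identity \<open>chain_boundary_boundary\<close>, read off coefficient by coefficient: as a product of
  incidence matrices it transfers to any ring of coefficients.
\<close>

lemma incidence_incidence:
  assumes \<sigma>: "singular_simplex (Suc p) X \<sigma>" and T: "finite T"
    "Poly_Mapping.keys (chain_boundary (Suc p) (frag_of \<sigma>)) \<subseteq> T"
  shows "(\<Sum>\<tau>\<in>T. incidence (Suc p) \<sigma> \<tau> * incidence p \<tau> \<rho>) = 0"
proof -
  have "(\<Sum>\<tau>\<in>T. incidence (Suc p) \<sigma> \<tau> * incidence p \<tau> \<rho>)
      = poly_mapping.lookup (chain_boundary p (chain_boundary (Suc p) (frag_of \<sigma>))) \<rho>"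
    unfolding lookup_chain_boundary[of p "chain_boundary (Suc p) (frag_of \<sigma>)" \<rho>]
    using T by (intro sum.mono_neutral_right) (auto simp: in_keys_iff)
  also have "\<dots> = 0"
    using \<sigma> by (simp add: chain_boundary_boundary_alt singular_chain_of)
  finally show ?thesis .
qed

context cring
begin

lemma boundary_map_superset:
  assumes "\<And>\<sigma>. c \<sigma> \<in> carrier R" and "finite S" and "{\<sigma>. c \<sigma> \<noteq> \<zero>} \<subseteq> S"
  shows "boundary_map R p c \<tau> = (\<Oplus>\<sigma>\<in>S. [(incidence p \<sigma> \<tau>)] \<cdot> c \<sigma>)"
  unfolding boundary_map_def
  using assms by (intro add.finprod_mono_neutral_cong_left) auto

lemma linear_boundary_map:
  "boundary_map R p \<in> linear_maps R (chains R p X) (chains R (p - 1) X)"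
proof (rule linear_mapsI)
  fix c assume c: "c \<in> carrier (chains R p X)"
  let ?S = "{\<sigma>. c \<sigma> \<noteq> \<zero>}"
  let ?T = "\<Union>\<sigma>\<in>?S. Poly_Mapping.keys (chain_boundary p (frag_of \<sigma>))"
  have fin: "finite ?S" and cK: "\<And>\<sigma>. c \<sigma> \<in> carrier R"
    using c by (auto simp: chains_sel)
  have supp: "{\<tau>. boundary_map R p c \<tau> \<noteq> \<zero>} \<subseteq> ?T"
  proof
    fix \<tau> assume "\<tau> \<in> {\<tau>. boundary_map R p c \<tau> \<noteq> \<zero>}"
    moreover have "boundary_map R p c \<tau> = \<zero>" if "\<tau> \<notin> ?T"
    proof -
      have "incidence p \<sigma> \<tau> = 0" if "\<sigma> \<in> ?S" for \<sigma>
        using that \<open>\<tau> \<notin> ?T\<close> by (auto simp: in_keys_iff)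
      then have "boundary_map R p c \<tau> = (\<Oplus>\<sigma>\<in>?S. \<zero>)"
        unfolding boundary_map_def by (intro finsum_cong') (auto simp: add_pow_int_0)
      then show ?thesis by (simp add: finsum_zero)
    qed
    ultimately show "\<tau> \<in> ?T" by blast
  qed
  moreover have "finite ?T" using fin by simp
  moreover have "singular_simplex (p - 1) X \<tau>" if \<tau>: "\<tau> \<in> ?T" for \<tau>
  proof -
    obtain \<sigma> where \<sigma>: "c \<sigma> \<noteq> \<zero>" "\<tau> \<in> Poly_Mapping.keys (chain_boundary p (frag_of \<sigma>))"
      using \<tau> by blast
    then have "singular_simplex p X \<sigma>" using c by (simp add: chains_sel)
    then have "singular_chain (p - Suc 0) X (chain_boundary p (frag_of \<sigma>))"
      by (simp add: singular_chain_boundary singular_chain_of)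
    with \<sigma>(2) show ?thesis by (auto simp: singular_chain_def)
  qed
  moreover have "boundary_map R p c \<tau> \<in> carrier R" for \<tau>
    unfolding boundary_map_def using cK by (intro finsum_closed) auto
  ultimately show "boundary_map R p c \<in> carrier (chains R (p - 1) X)"
    unfolding chains_sel using finite_subset by blast
next
  fix c c' assume c: "c \<in> carrier (chains R p X)" "c' \<in> carrier (chains R p X)"
  let ?S = "{\<sigma>. c \<sigma> \<noteq> \<zero>} \<union> {\<sigma>. c' \<sigma> \<noteq> \<zero>}"
  have fin: "finite ?S" and cK: "\<And>\<sigma>. c \<sigma> \<in> carrier R" "\<And>\<sigma>. c' \<sigma> \<in> carrier R"
    using c by (auto simp: chains_sel)
  have "boundary_map R p (\<lambda>\<sigma>. c \<sigma> \<oplus> c' \<sigma>) \<tau> = boundary_map R p c \<tau> \<oplus> boundary_map R p c' \<tau>" for \<tau>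
  proof -
    have "boundary_map R p (\<lambda>\<sigma>. c \<sigma> \<oplus> c' \<sigma>) \<tau> = (\<Oplus>\<sigma>\<in>?S. [(incidence p \<sigma> \<tau>)] \<cdot> (c \<sigma> \<oplus> c' \<sigma>))"
      using cK by (intro boundary_map_superset[OF _ fin]) auto
    also have "\<dots> = (\<Oplus>\<sigma>\<in>?S. [(incidence p \<sigma> \<tau>)] \<cdot> c \<sigma> \<oplus> [(incidence p \<sigma> \<tau>)] \<cdot> c' \<sigma>)"
      using cK by (intro finsum_cong') (auto simp: add.int_pow_distrib)
    also have "\<dots> = (\<Oplus>\<sigma>\<in>?S. [(incidence p \<sigma> \<tau>)] \<cdot> c \<sigma>) \<oplus> (\<Oplus>\<sigma>\<in>?S. [(incidence p \<sigma> \<tau>)] \<cdot> c' \<sigma>)"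
      using cK by (intro finsum_addf) auto
    also have "\<dots> = boundary_map R p c \<tau> \<oplus> boundary_map R p c' \<tau>"
      using boundary_map_superset[OF cK(1) fin] boundary_map_superset[OF cK(2) fin] by simp
    finally show ?thesis .
  qed
  then show "boundary_map R p (c \<oplus>\<^bsub>chains R p X\<^esub> c')
      = boundary_map R p c \<oplus>\<^bsub>chains R (p - 1) X\<^esub> boundary_map R p c'"
    by (simp add: chains_sel fun_eq_iff)
next
  fix a c assume a: "a \<in> carrier R" and c: "c \<in> carrier (chains R p X)"
  let ?S = "{\<sigma>. c \<sigma> \<noteq> \<zero>}"
  have fin: "finite ?S" and cK: "\<And>\<sigma>. c \<sigma> \<in> carrier R"
    using c by (auto simp: chains_sel)
  have "boundary_map R p (\<lambda>\<sigma>. a \<otimes> c \<sigma>) \<tau> = a \<otimes> boundary_map R p c \<tau>" for \<tau>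
  proof -
    have "boundary_map R p (\<lambda>\<sigma>. a \<otimes> c \<sigma>) \<tau> = (\<Oplus>\<sigma>\<in>?S. [(incidence p \<sigma> \<tau>)] \<cdot> (a \<otimes> c \<sigma>))"
      using a cK by (intro boundary_map_superset[OF _ fin]) auto
    also have "\<dots> = (\<Oplus>\<sigma>\<in>?S. a \<otimes> [(incidence p \<sigma> \<tau>)] \<cdot> c \<sigma>)"
      using a cK by (intro finsum_cong') (auto simp: add_pow_rdistr_int)
    also have "\<dots> = a \<otimes> (\<Oplus>\<sigma>\<in>?S. [(incidence p \<sigma> \<tau>)] \<cdot> c \<sigma>)"
      using a cK fin by (intro finsum_rdistr[symmetric]) auto
    finally show ?thesis by (simp add: boundary_map_def)
  qed
  then show "boundary_map R p (a \<odot>\<^bsub>chains R p X\<^esub> c) = a \<odot>\<^bsub>chains R (p - 1) X\<^esub> boundary_map R p c"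
    by (simp add: chains_sel fun_eq_iff)
qed

text \<open>
  Interchanging the two summations turns the double boundary into a combination of the coefficients of
  \<open>c\<close> by entries of the product of two consecutive incidence matrices.
\<close>

lemma boundary_map_boundary_map:
  assumes c: "c \<in> carrier (chains R (Suc p) X)"
  shows "boundary_map R p (boundary_map R (Suc p) c) = (\<lambda>\<rho>. \<zero>)"
proof
  fix \<rho>
  let ?S = "{\<sigma>. c \<sigma> \<noteq> \<zero>}"
  \<comment> \<open>Coefficients may cancel in \<open>K\<close>, so the simplices that occur in the integral boundaries have to be
    added to the support of the boundary of \<open>c\<close>.\<close>
  define T where "T = {\<tau>. boundary_map R (Suc p) c \<tau> \<noteq> \<zero>} \<union>
    (\<Union>\<sigma>\<in>?S. Poly_Mapping.keys (chain_boundary (Suc p) (frag_of \<sigma>)))"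
  have fin: "finite ?S" and cK: "\<And>\<sigma>. c \<sigma> \<in> carrier R"
    using c by (auto simp: chains_sel)
  have dc: "boundary_map R (Suc p) c \<in> carrier (chains R p X)"
    using linear_maps_closed[OF linear_boundary_map c] by simp
  then have finT: "finite T" and dK: "\<And>\<tau>. boundary_map R (Suc p) c \<tau> \<in> carrier R"
    using fin by (auto simp: T_def chains_sel)
  have "boundary_map R p (boundary_map R (Suc p) c) \<rho>
      = (\<Oplus>\<tau>\<in>T. [(incidence p \<tau> \<rho>)] \<cdot> boundary_map R (Suc p) c \<tau>)"
    by (rule boundary_map_superset[OF dK finT]) (simp add: T_def)
  also have "\<dots> = (\<Oplus>\<tau>\<in>T. \<Oplus>\<sigma>\<in>?S. [(incidence (Suc p) \<sigma> \<tau> * incidence p \<tau> \<rho>)] \<cdot> c \<sigma>)"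
    using cK fin by (intro finsum_cong') (auto simp: boundary_map_def add_pow_int_finsum add.int_pow_pow)
  also have "\<dots> = (\<Oplus>\<sigma>\<in>?S. \<Oplus>\<tau>\<in>T. [(incidence (Suc p) \<sigma> \<tau> * incidence p \<tau> \<rho>)] \<cdot> c \<sigma>)"
    using cK by (intro finsum_swap[OF finT fin]) auto
  also have "\<dots> = (\<Oplus>\<sigma>\<in>?S. \<zero>)"
  proof (rule finsum_cong')
    fix \<sigma> assume \<sigma>: "\<sigma> \<in> ?S"
    have "(\<Sum>\<tau>\<in>T. incidence (Suc p) \<sigma> \<tau> * incidence p \<tau> \<rho>) = 0"
      using c \<sigma> by (intro incidence_incidence[OF _ finT]) (auto simp: chains_sel T_def)
    then show "(\<Oplus>\<tau>\<in>T. [(incidence (Suc p) \<sigma> \<tau> * incidence p \<tau> \<rho>)] \<cdot> c \<sigma>) = \<zero>"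
      using finsum_add_pow_int[OF finT cK] by (simp add: add_pow_int_0)
  qed auto
  finally show "boundary_map R p (boundary_map R (Suc p) c) \<rho> = \<zero>"
    by (simp add: finsum_zero)
qed

end

lemma
  assumes K: "cring K"
  shows submodule_cycles: "submodule (cycles K p X) K (chains K p X)"
    and submodule_boundaries: "submodule (boundaries K p X) K (chains K p X)"
    and boundaries_subset_cycles: "boundaries K p X \<subseteq> cycles K p X"
proof -
  interpret K: cring K by (rule K)
  show "submodule (cycles K p X) K (chains K p X)"
    using submodule_kernel[OF module_chains[OF K] module_chains[OF K] K.linear_boundary_map[of p X]]
    by (simp add: cycles_def chains_sel(2))
  show "submodule (boundaries K p X) K (chains K p X)"
    using submodule_image[OF module_chains[OF K] module_chains[OF K] K.linear_boundary_map[of "Suc p" X]]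
    by (simp add: boundaries_def)
  show "boundaries K p X \<subseteq> cycles K p X"
    using K.boundary_map_boundary_map linear_maps_closed[OF K.linear_boundary_map[of "Suc p" X]]
    by (auto simp: boundaries_def cycles_def)
qed

lemma module_cycles:
  assumes "cring K"
  shows "module K ((chains K p X)\<lparr>carrier := cycles K p X\<rparr>)"
  by (rule submodule.submodule_is_module[OF submodule_cycles module_chains]) fact+

lemma submodule_boundaries_cycles:
  assumes "cring K"
  shows "submodule (boundaries K p X) K ((chains K p X)\<lparr>carrier := cycles K p X\<rparr>)"
  using submodule.submodule_is_module[OF submodule_boundaries module_chains, OF assms assms]
    boundaries_subset_cycles[OF assms, of p X]
  by (intro module.module_incl_imp_submodule[OF module_cycles[OF assms]]) auto

text \<open>
  Addition of chains does not refer to the space, so cosets may be formed in any of the chain modules.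
\<close>

lemma homology_coset: "B +>\<^bsub>(chains K p X)\<lparr>carrier := Z\<rparr>\<^esub> c = B +>\<^bsub>chains K p Y\<^esub> c"
  by (simp add: a_r_coset_def' chains_def)

lemma homology_carrier:
  "carrier (homology K p X) = (\<lambda>c. boundaries K p X +>\<^bsub>(chains K p X)\<lparr>carrier := cycles K p X\<rparr>\<^esub> c) ` cycles K p X"
  by (simp add: homology_def carrier_quotient)

abbreviation homology_class where
  "homology_class K p X c \<equiv> boundaries K p X +>\<^bsub>(chains K p X)\<lparr>carrier := cycles K p X\<rparr>\<^esub> c"

text \<open>
  A subspace enters only through its singular simplices, which is why inclusion of spaces is expressed by
  inclusion of simplices.
\<close>

context
  fixes K :: "('k, 'm) ring_scheme" and X Y :: "'a topology"
  assumes K: "cring K"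
    and incl: "\<And>p \<sigma>. singular_simplex p X \<sigma> \<Longrightarrow> singular_simplex p Y \<sigma>"
begin

lemma cycles_mono: "cycles K p X \<subseteq> cycles K p Y"
  using incl by (auto simp: cycles_def chains_sel)

lemma boundaries_mono: "boundaries K p X \<subseteq> boundaries K p Y"
  using incl by (auto simp: boundaries_def chains_sel)

text \<open>
  A representative of the class of \<open>c\<close> differs from \<open>c\<close> by a boundary of \<open>X\<close>, which is also a boundary
  of \<open>Y\<close>; hence all members of the union that defines \<open>homology_incl\<close> are the same coset.
\<close>

lemma homology_incl_class:
  assumes c: "c \<in> cycles K p X"
  shows "homology_incl K p Y (homology_class K p X c) = homology_class K p Y c"
proof -
  interpret B: abelian_subgroup "boundaries K p Y" "chains K p Y"
    by (rule submodule_abelian_subgroup[OF module_chains submodule_boundaries]) (fact K)+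
  interpret BX: abelian_subgroup "boundaries K p X" "chains K p X"
    by (rule submodule_abelian_subgroup[OF module_chains submodule_boundaries]) (fact K)+
  have cX: "c \<in> carrier (chains K p X)" and cY: "c \<in> carrier (chains K p Y)"
    using c cycles_mono by (auto simp: cycles_def)
  let ?C = "boundaries K p X +>\<^bsub>chains K p X\<^esub> c"
  have "boundaries K p Y +>\<^bsub>chains K p Y\<^esub> c' = boundaries K p Y +>\<^bsub>chains K p Y\<^esub> c" if "c' \<in> ?C" for c'
  proof -
    have "c' \<in> boundaries K p Y +>\<^bsub>chains K p Y\<^esub> c"
      using that boundaries_mono by (auto simp: a_r_coset_def' chains_sel)
    then show ?thesis
      using B.a_repr_independence' cY by metis
  qed
  then have "(\<Union>c'\<in>?C. boundaries K p Y +>\<^bsub>chains K p Y\<^esub> c') = (\<Union>c'\<in>?C. boundaries K p Y +>\<^bsub>chains K p Y\<^esub> c)"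
    by (rule SUP_cong[OF refl])
  moreover have "c \<in> ?C" by (rule BX.a_rcos_self[OF cX])
  ultimately show ?thesis
    unfolding homology_incl_def homology_coset[of _ K p X _ _ X] homology_coset[of _ K p Y _ _ Y]
    by blast
qed

lemma linear_homology_incl: "homology_incl K p Y \<in> linear_maps K (homology K p X) (homology K p Y)"
proof -
  note X = module_cycles[OF K] submodule_boundaries_cycles[OF K]
  interpret ZX: module K "(chains K p X)\<lparr>carrier := cycles K p X\<rparr>" by (rule X)
  interpret ZY: module K "(chains K p Y)\<lparr>carrier := cycles K p Y\<rparr>" by (rule X)
  have add: "c \<oplus>\<^bsub>(chains K p X)\<lparr>carrier := cycles K p X\<rparr>\<^esub> c' = c \<oplus>\<^bsub>(chains K p Y)\<lparr>carrier := cycles K p Y\<rparr>\<^esub> c'"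
    and smult: "a \<odot>\<^bsub>(chains K p X)\<lparr>carrier := cycles K p X\<rparr>\<^esub> c = a \<odot>\<^bsub>(chains K p Y)\<lparr>carrier := cycles K p Y\<rparr>\<^esub> c" for a c c'
    by (simp_all add: chains_sel)
  show ?thesis
  proof (rule linear_mapsI)
    fix C assume "C \<in> carrier (homology K p X)"
    then show "homology_incl K p Y C \<in> carrier (homology K p Y)"
      using cycles_mono[of p] by (auto simp: homology_carrier homology_incl_class)
  next
    fix C C' assume "C \<in> carrier (homology K p X)" "C' \<in> carrier (homology K p X)"
    then obtain c c' where c: "c \<in> cycles K p X" "C = homology_class K p X c"
      "c' \<in> cycles K p X" "C' = homology_class K p X c'"
      by (auto simp: homology_carrier)
    have cY: "c \<in> cycles K p Y" "c' \<in> cycles K p Y" using c cycles_mono by auto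
    have "C \<oplus>\<^bsub>homology K p X\<^esub> C' = homology_class K p X (c \<oplus>\<^bsub>(chains K p X)\<lparr>carrier := cycles K p X\<rparr>\<^esub> c')"
      using c coset_add[OF X] by (simp add: homology_def)
    moreover have "c \<oplus>\<^bsub>(chains K p X)\<lparr>carrier := cycles K p X\<rparr>\<^esub> c' \<in> cycles K p X"
      using c ZX.M.a_closed by simp
    ultimately show "homology_incl K p Y (C \<oplus>\<^bsub>homology K p X\<^esub> C')
        = homology_incl K p Y C \<oplus>\<^bsub>homology K p Y\<^esub> homology_incl K p Y C'"
      using c cY coset_add[OF X, of c p Y c'] by (simp only: homology_incl_class add) (simp add: homology_def)
  next
    fix a C assume a: "a \<in> carrier K" and "C \<in> carrier (homology K p X)"
    then obtain c where c: "c \<in> cycles K p X" "C = homology_class K p X c"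
      by (auto simp: homology_carrier)
    have cY: "c \<in> cycles K p Y" using c cycles_mono by auto
    have "a \<odot>\<^bsub>homology K p X\<^esub> C = homology_class K p X (a \<odot>\<^bsub>(chains K p X)\<lparr>carrier := cycles K p X\<rparr>\<^esub> c)"
      using a c coset_smult[OF X] by (simp add: homology_def)
    moreover have "a \<odot>\<^bsub>(chains K p X)\<lparr>carrier := cycles K p X\<rparr>\<^esub> c \<in> cycles K p X"
      using a c ZX.smult_closed by simp
    ultimately show "homology_incl K p Y (a \<odot>\<^bsub>homology K p X\<^esub> C) = a \<odot>\<^bsub>homology K p Y\<^esub> homology_incl K p Y C"
      using a c cY coset_smult[OF X, of a c p Y] by (simp only: homology_incl_class smult) (simp add: homology_def)
  qed
qed

end

theorem vect_functor_homology:
  fixes sub :: "'o \<Rightarrow> 'a topology"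
  assumes K: "cring K"
    and incl: "\<And>p q m \<sigma>. p \<in> P \<Longrightarrow> q \<in> P \<Longrightarrow> r p q \<Longrightarrow> singular_simplex m (sub p) \<sigma> \<Longrightarrow> singular_simplex m (sub q) \<sigma>"
  shows "vect_functor K P r \<lparr>obj = (\<lambda>p. homology K n (sub p)), mor = (\<lambda>p q. homology_incl K n (sub q))\<rparr>"
  unfolding vect_functor_def diagram.simps
proof (intro conjI ballI impI)
  fix p show "module K (homology K n (sub p))"
    unfolding homology_def by (rule module_quotient[OF module_cycles submodule_boundaries_cycles]) (fact K)+
next
  fix p q assume "p \<in> P" "q \<in> P" "r p q"
  then show "homology_incl K n (sub q) \<in> linear_maps K (homology K n (sub p)) (homology K n (sub q))"
    using incl by (intro linear_homology_incl[OF K]) blast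
next
  fix p C assume "C \<in> carrier (homology K n (sub p))"
  then show "homology_incl K n (sub p) C = C"
    using homology_incl_class[OF K, of "sub p" "sub p"] by (auto simp: homology_carrier)
next
  fix p q s C assume *: "p \<in> P" "q \<in> P" "s \<in> P" "r p q" "r q s" "C \<in> carrier (homology K n (sub p))"
  then obtain c where c: "c \<in> cycles K n (sub p)" and C: "C = homology_class K n (sub p) c"
    by (auto simp: homology_carrier)
  have pq: "singular_simplex m (sub q) \<sigma>" if "singular_simplex m (sub p) \<sigma>" for m \<sigma>
    using incl[OF *(1,2,4) that] .
  have qs: "singular_simplex m (sub s) \<sigma>" if "singular_simplex m (sub q) \<sigma>" for m \<sigma>
    using incl[OF *(2,3,5) that] .
  have cq: "c \<in> cycles K n (sub q)" using cycles_mono[OF K pq] c by blast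
  have "homology_incl K n (sub q) C = homology_class K n (sub q) c"
    unfolding C by (rule homology_incl_class[OF K pq c])
  moreover have "homology_incl K n (sub s) (homology_class K n (sub q) c) = homology_class K n (sub s) c"
    by (rule homology_incl_class[OF K qs cq])
  moreover have "homology_incl K n (sub s) C = homology_class K n (sub s) c"
    unfolding C by (rule homology_incl_class[OF K _ c]) (rule qs[OF pq])
  ultimately show "homology_incl K n (sub s) (homology_incl K n (sub q) C) = homology_incl K n (sub s) C"
    by simp
qed


section \<open>Geometry of directions\<close>

lemma L2_set_dot: "L2_set x {..<d} = sqrt (dot d x x)"
  by (simp add: L2_set_def dot_def power2_eq_square)

lemma dot_commute: "dot d x y = dot d y x"
  by (simp add: dot_def mult.commute)

lemma dot_self_nonneg: "0 \<le> dot d x x"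
  by (simp add: dot_def sum_nonneg)

lemma dot_unit_sphere: "v \<in> unit_sphere d \<Longrightarrow> dot d v v = 1"
  by (simp add: unit_sphere_def L2_set_dot)

lemma dot_unit_disc: "x \<in> unit_disc d \<Longrightarrow> dot d x x \<le> 1"
  by (simp add: unit_disc_def L2_set_dot)

lemma dot_le_L2_set: "dot d x y \<le> L2_set x {..<d} * L2_set y {..<d}"
proof -
  have "dot d x y \<le> (\<Sum>i<d. \<bar>x i\<bar> * \<bar>y i\<bar>)"
    unfolding dot_def by (rule sum_mono) (metis abs_ge_self abs_mult)
  also have "\<dots> \<le> L2_set x {..<d} * L2_set y {..<d}"
    by (rule L2_set_mult_ineq)
  finally show ?thesis .
qed

lemma dot_uminus_left: "dot d (\<lambda>i. - x i) y = - dot d x y"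
  by (simp add: dot_def sum_negf)

lemma dot_uminus_self: "dot d (\<lambda>i. - x i) (\<lambda>i. - x i) = dot d x x"
  by (simp add: dot_def)

lemma abs_dot_le_1:
  assumes "dot d x x \<le> 1" "dot d y y \<le> 1"
  shows "\<bar>dot d x y\<bar> \<le> 1"
proof -
  have le: "dot d z y \<le> 1" if "dot d z z \<le> 1" for z
  proof -
    have "dot d z y \<le> sqrt (dot d z z) * sqrt (dot d y y)"
      using dot_le_L2_set by (simp add: L2_set_dot)
    also have "\<dots> \<le> 1 * 1"
      using that assms(2) dot_self_nonneg by (intro mult_mono) auto
    finally show ?thesis by simp
  qed
  have "- dot d x y \<le> 1"
    using le[of "\<lambda>i. - x i", unfolded dot_uminus_self] assms(1) by (simp add: dot_uminus_left)
  with le[OF assms(1)] show ?thesis by simp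
qed

text \<open>
  For unit vectors this is a form of the triangle inequality for angles. Subtract from \<open>x\<close> and \<open>w\<close> their
  components along \<open>v\<close>, say \<open>s v\<close> and \<open>c v\<close>; the remainders have norms at most \<open>sqrt (1 - s\<^sup>2)\<close> and
  \<open>sqrt (1 - c\<^sup>2)\<close>, so Cauchy-Schwarz bounds \<open>x \<cdot> w\<close> by
  \<open>s c + sqrt (1 - s\<^sup>2) sqrt (1 - c\<^sup>2)\<close>, which is the cosine of \<open>arccos s - arccos c\<close>. A vector \<open>x\<close> inside the
  disc is admitted because \<open>M\<close> need not lie on the sphere.
\<close>

lemma dot_le_cos_arccos_diff:
  assumes x: "dot d x x \<le> 1" and v: "dot d v v = 1" and w: "dot d w w = 1"
  shows "dot d x w \<le> cos (arccos (dot d x v) - arccos (dot d v w))"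
proof -
  define s where "s = dot d x v"
  define c where "c = dot d v w"
  have s: "\<bar>s\<bar> \<le> 1" and c: "\<bar>c\<bar> \<le> 1"
    using x v w by (auto simp: s_def c_def intro!: abs_dot_le_1)
  have expand: "dot d (\<lambda>i. y i - a * v i) (\<lambda>i. z i - b * v i)
      = dot d y z - b * dot d y v - a * dot d v z + a * b" for y z a b
  proof -
    have "dot d (\<lambda>i. y i - a * v i) (\<lambda>i. z i - b * v i)
        = dot d y z - b * dot d y v - a * dot d v z + a * b * dot d v v"
      by (simp add: dot_def algebra_simps sum.distrib sum_subtractf sum_distrib_left)
    then show ?thesis by (simp add: v)
  qed
  let ?x = "\<lambda>i. x i - s * v i" and ?w = "\<lambda>i. w i - c * v i"
  have "dot d x w - s * c = dot d ?x ?w"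
    unfolding expand by (simp add: s_def c_def)
  also have "\<dots> \<le> sqrt (dot d ?x ?x) * sqrt (dot d ?w ?w)"
    using dot_le_L2_set by (simp add: L2_set_dot)
  also have "dot d ?x ?x = dot d x x - s\<^sup>2"
    unfolding expand by (simp add: s_def dot_commute[of d v x] power2_eq_square)
  also have "dot d ?w ?w = 1 - c\<^sup>2"
    unfolding expand by (simp add: c_def w dot_commute[of d w v] power2_eq_square)
  also have "sqrt (dot d x x - s\<^sup>2) * sqrt (1 - c\<^sup>2) \<le> sqrt (1 - s\<^sup>2) * sqrt (1 - c\<^sup>2)"
    using x c by (intro mult_right_mono) (auto simp: abs_square_le_1)
  finally have "dot d x w \<le> s * c + sqrt (1 - s\<^sup>2) * sqrt (1 - c\<^sup>2)" by simp
  also have "\<dots> = cos (arccos s - arccos c)"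
    using s c by (simp add: cos_diff sin_arccos_abs cos_arccos_abs)
  finally show ?thesis by (simp add: s_def c_def)
qed

lemma geodesic_dist_nonneg:
  assumes "dot d v v = 1" "dot d w w = 1"
  shows "0 \<le> geodesic_dist d v w"
  using abs_dot_le_1[of d v w] assms by (auto simp: geodesic_dist_def intro!: arccos_lbound)

lemma geodesic_dist_self: "dot d v v = 1 \<Longrightarrow> geodesic_dist d v v = 0"
  by (simp add: geodesic_dist_def)

lemma geodesic_dist_commute: "geodesic_dist d v w = geodesic_dist d w v"
  by (simp add: geodesic_dist_def dot_commute)

text \<open>
  The preceding bound is applied to \<open>-u\<close>: with \<open>a\<close> the angle between \<open>u\<close> and \<open>v\<close> and \<open>b\<close> that
  between \<open>v\<close> and \<open>w\<close>, it reads \<open>- (u \<cdot> w) \<le> cos (\<pi> - a - b)\<close>, that is \<open>cos (a + b) \<le> u \<cdot> w\<close>.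
\<close>

lemma geodesic_dist_triangle:
  assumes u: "dot d u u = 1" and v: "dot d v v = 1" and w: "dot d w w = 1"
  shows "geodesic_dist d u w \<le> geodesic_dist d u v + geodesic_dist d v w"
proof -
  define a where "a = geodesic_dist d u v"
  define b where "b = geodesic_dist d v w"
  have uv: "\<bar>dot d u v\<bar> \<le> 1" and uw: "\<bar>dot d u w\<bar> \<le> 1"
    using u v w by (auto intro!: abs_dot_le_1)
  have ab: "0 \<le> a" "0 \<le> b"
    unfolding a_def b_def using u v w by (simp_all add: geodesic_dist_nonneg)
  show ?thesis
  proof (cases "a + b \<le> pi")
    case True
    have "dot d (\<lambda>i. - u i) (\<lambda>i. - u i) \<le> 1"
      using u by (simp add: dot_uminus_self)
    from dot_le_cos_arccos_diff[OF this v w]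
    have "- dot d u w \<le> cos (arccos (- dot d u v) - b)"
      by (simp add: dot_uminus_left b_def geodesic_dist_def)
    also have "arccos (- dot d u v) = pi - a"
      using uv by (simp add: arccos_minus a_def geodesic_dist_def abs_le_iff)
    also have "cos (pi - a - b) = - cos (a + b)"
      using cos_pi_minus[of "a + b"] by (simp add: diff_diff_eq)
    finally have "cos (a + b) \<le> dot d u w" by simp
    then have "arccos (dot d u w) \<le> arccos (cos (a + b))"
      using uw by (intro arccos_le_arccos) (auto simp: abs_le_iff)
    also have "\<dots> = a + b"
      using True ab by (intro arccos_cos) auto
    finally show ?thesis by (simp add: a_def b_def geodesic_dist_def)
  next
    case False
    have "geodesic_dist d u w \<le> pi"
      using uw by (auto simp: geodesic_dist_def intro: arccos_ubound)
    with False show ?thesis by (simp add: a_def b_def)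
  qed
qed

lemma chordal_dist_nonneg: "0 \<le> chordal_dist d v w"
  by (simp add: chordal_dist_def)

lemma chordal_dist_self: "chordal_dist d v v = 0"
  by (simp add: chordal_dist_def L2_set_def)

lemma chordal_dist_commute: "chordal_dist d v w = chordal_dist d w v"
  by (simp add: chordal_dist_def L2_set_def power2_commute)

lemma chordal_dist_triangle: "chordal_dist d u w \<le> chordal_dist d u v + chordal_dist d v w"
  using L2_set_triangle_ineq[of "\<lambda>i. u i - v i" "\<lambda>i. v i - w i" "{..<d}"]
  by (simp add: chordal_dist_def)

lemma sublevel_chordal_mono:
  assumes x: "x \<in> unit_disc d" and le: "dot d x v \<le> \<alpha>" "\<alpha> + chordal_dist d v w \<le> \<beta>"
  shows "dot d x w \<le> \<beta>"
proof -
  have "dot d x w - dot d x v = dot d x (\<lambda>i. w i - v i)"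
    by (simp add: dot_def sum_subtractf right_diff_distrib)
  also have "\<dots> \<le> L2_set x {..<d} * L2_set (\<lambda>i. w i - v i) {..<d}"
    by (rule dot_le_L2_set)
  also have "\<dots> \<le> 1 * L2_set (\<lambda>i. w i - v i) {..<d}"
    using x by (intro mult_right_mono) (auto simp: unit_disc_def L2_set_nonneg)
  also have "\<dots> = chordal_dist d v w"
    by (simp add: chordal_dist_def L2_set_def power2_commute)
  finally show ?thesis using le by simp
qed

text \<open>
  Since \<open>x \<cdot> v \<le> cos (-\<alpha>)\<close>, the angle \<open>arccos (x \<cdot> v)\<close> is at least \<open>-\<alpha>\<close>, and it still exceeds \<open>-\<beta>\<close> or
  equals it after the angle between \<open>v\<close> and \<open>w\<close> has been subtracted; on \<open>[0, \<pi>]\<close> the cosine decreases.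
\<close>

lemma sublevel_geodesic_mono:
  assumes x: "x \<in> unit_disc d" and vw: "v \<in> unit_sphere d" "w \<in> unit_sphere d"
    and range: "-pi \<le> \<alpha>" "\<beta> \<le> 0"
    and le: "dot d x v \<le> cos \<alpha>" "\<alpha> + geodesic_dist d v w \<le> \<beta>"
  shows "dot d x w \<le> cos \<beta>"
proof -
  note norms = dot_unit_disc[OF x] dot_unit_sphere[OF vw(1)] dot_unit_sphere[OF vw(2)]
  have xv: "\<bar>dot d x v\<bar> \<le> 1"
    using norms by (auto intro!: abs_dot_le_1)
  have vw0: "0 \<le> geodesic_dist d v w"
    by (rule geodesic_dist_nonneg[OF norms(2,3)])
  have "- \<alpha> = arccos (cos (- \<alpha>))"
    using range le vw0 by (intro arccos_cos[symmetric]) auto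
  also have "\<dots> \<le> arccos (dot d x v)"
    using le(1) xv by (intro arccos_le_arccos) (auto simp: abs_le_iff)
  finally have *: "- \<beta> \<le> arccos (dot d x v) - geodesic_dist d v w"
    using le(2) by simp
  have "arccos (dot d x v) \<le> pi"
    using xv by (intro arccos_ubound) auto
  have "dot d x w \<le> cos (arccos (dot d x v) - geodesic_dist d v w)"
    unfolding geodesic_dist_def by (rule dot_le_cos_arccos_diff[OF norms])
  also have "\<dots> \<le> cos (- \<beta>)"
    using * range vw0 \<open>arccos (dot d x v) \<le> pi\<close> by (intro cos_monotone_0_pi_le) auto
  finally show ?thesis by simp
qed

text \<open>
  A morphism of space-time is an inclusion of sublevel sets: by \<open>mono\<close> if it respects the light cone, and
  because the sublevel set at time \<open>Sup X\<close> is all of \<open>M\<close> otherwise.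
\<close>

lemma vect_functor_directional_PH:
  assumes K: "cring K" and M: "M \<subseteq> unit_disc d" and A: "A \<subseteq> unit_sphere d"
    and top: "h (Sup X) = 1"
    and mono: "\<And>x v w \<alpha> \<beta>. x \<in> unit_disc d \<Longrightarrow> v \<in> unit_sphere d \<Longrightarrow> w \<in> unit_sphere d \<Longrightarrow>
      \<alpha> \<in> X \<Longrightarrow> \<beta> \<in> X \<Longrightarrow> \<alpha> + \<delta> v w \<le> \<beta> \<Longrightarrow> dot d x v \<le> h \<alpha> \<Longrightarrow> dot d x w \<le> h \<beta>"
  shows "vect_functor K (A \<times> X) (spacetime_le X \<delta>) (directional_PH K n d h M)"
  unfolding directional_PH_def Let_def
proof (rule vect_functor_homology[OF K])
  fix p q m \<sigma> assume "p \<in> A \<times> X" "q \<in> A \<times> X" and le: "spacetime_le X \<delta> p q"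
    and \<sigma>: "singular_simplex m (case p of (v, \<alpha>) \<Rightarrow> subtopology (Euclidean_space d) (sublevel d M v (h \<alpha>))) \<sigma>"
  then obtain v \<alpha> w \<beta> where p: "p = (v, \<alpha>)" "q = (w, \<beta>)" "v \<in> A" "w \<in> A" "\<alpha> \<in> X" "\<beta> \<in> X"
    by blast
  have "sublevel d M v (h \<alpha>) \<subseteq> sublevel d M w (h \<beta>)"
  proof
    fix x assume "x \<in> sublevel d M v (h \<alpha>)"
    then have x: "x \<in> M" "x \<in> unit_disc d" "dot d x v \<le> h \<alpha>"
      using M by (auto simp: sublevel_def)
    have vw: "v \<in> unit_sphere d" "w \<in> unit_sphere d"
      using p A by auto
    have "dot d x w \<le> 1"
      using abs_dot_le_1[of d x w] dot_unit_disc[OF x(2)] dot_unit_sphere[OF vw(2)] by simp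
    moreover have "\<alpha> + \<delta> v w \<le> \<beta> \<or> \<beta> = Sup X"
      using le by (simp add: p spacetime_le_def)
    ultimately have "dot d x w \<le> h \<beta>"
      using mono[OF x(2) vw p(5,6) _ x(3)] top by auto
    with x(1) show "x \<in> sublevel d M w (h \<beta>)"
      by (simp add: sublevel_def)
  qed
  with \<sigma> show "singular_simplex m (case q of (v, \<alpha>) \<Rightarrow> subtopology (Euclidean_space d) (sublevel d M v (h \<alpha>))) \<sigma>"
    by (auto simp: p intro: singular_simplex_mono)
qed

section \<open>Stability of the interpolated persistent homology transform\<close>

theorem theorem3p10:
  fixes K :: "('k, 'm) ring_scheme"
    and Ostr :: "nat \<Rightarrow> (nat \<Rightarrow> real) set set"
    and d n :: nat
    and M A :: "(nat \<Rightarrow> real) set"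
    and X :: "real set"
    and \<delta> :: "(nat \<Rightarrow> real) \<Rightarrow> (nat \<Rightarrow> real) \<Rightarrow> real"
    and h :: "real \<Rightarrow> real"
  assumes "field K"
    and "o_minimal Ostr"
    and "constructible Ostr d M"
    and "M \<subseteq> unit_disc d"
    and "A \<subseteq> unit_sphere d"
    and "(X = {-1..1} \<and> \<delta> = chordal_dist d \<and> h = (\<lambda>\<alpha>. \<alpha>)) \<or>
         (X = {-pi..0} \<and> \<delta> = geodesic_dist d \<and> h = cos)"
    and "r = spacetime_le X \<delta>"
    and "G = directional_PH K n d h M"
  shows "lipschitz1_to_pmod K X (unit_sphere d) \<delta>
           (\<lambda>w. precomp (left_kan K (A \<times> X) r G) (Pair w)) \<and>
         lipschitz1_to_pmod K X (unit_sphere d) \<delta>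
           (\<lambda>w. precomp (right_kan (A \<times> X) r G) (Pair w)) \<and>
         lipschitz1_to_pmod K X (unit_sphere d) \<delta>
           (\<lambda>w. precomp (center_kan K (A \<times> X) r G) (Pair w))"
proof -
  let ?S = "unit_sphere d"
  have K: "cring K"
    using \<open>field K\<close> by (simp add: field.axioms(1) domain.axioms(1))
  obtain a b where X: "X = {a..b}" and ab: "a \<le> b" and top: "h b = 1"
    and nonneg: "\<And>v w. v \<in> ?S \<Longrightarrow> w \<in> ?S \<Longrightarrow> 0 \<le> \<delta> v w"
    and refl: "\<And>v. v \<in> ?S \<Longrightarrow> \<delta> v v = 0"
    and sym: "\<And>v w. v \<in> ?S \<Longrightarrow> w \<in> ?S \<Longrightarrow> \<delta> v w = \<delta> w v"
    and triangle: "\<And>u v w. u \<in> ?S \<Longrightarrow> v \<in> ?S \<Longrightarrow> w \<in> ?S \<Longrightarrow> \<delta> u w \<le> \<delta> u v + \<delta> v w"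
    and mono: "\<And>x v w \<alpha> \<beta>. x \<in> unit_disc d \<Longrightarrow> v \<in> ?S \<Longrightarrow> w \<in> ?S \<Longrightarrow> \<alpha> \<in> {a..b} \<Longrightarrow> \<beta> \<in> {a..b} \<Longrightarrow>
      \<alpha> + \<delta> v w \<le> \<beta> \<Longrightarrow> dot d x v \<le> h \<alpha> \<Longrightarrow> dot d x w \<le> h \<beta>"
    using assms(6)
  proof (elim disjE conjE)
    assume *: "X = {-1..1}" "\<delta> = chordal_dist d" "h = (\<lambda>\<alpha>. \<alpha>)"
    show thesis
    proof (rule that[of "-1" 1], unfold *)
      show "dot d x w \<le> \<beta>"
        if "x \<in> unit_disc d" "dot d x v \<le> \<alpha>" "\<alpha> + chordal_dist d v w \<le> \<beta>" for x v w \<alpha> \<beta>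
        by (rule sublevel_chordal_mono[OF that])
    qed (rule refl chordal_dist_nonneg chordal_dist_self chordal_dist_commute
        chordal_dist_triangle | simp)+
  next
    assume *: "X = {-pi..0}" "\<delta> = geodesic_dist d" "h = cos"
    show thesis
    proof (rule that[of "-pi" 0], unfold *)
      show "dot d x w \<le> cos \<beta>"
        if "x \<in> unit_disc d" "v \<in> ?S" "w \<in> ?S" "\<alpha> \<in> {-pi..0}" "\<beta> \<in> {-pi..0}"
          "\<alpha> + geodesic_dist d v w \<le> \<beta>" "dot d x v \<le> cos \<alpha>" for x v w \<alpha> \<beta>
        using that by (intro sublevel_geodesic_mono[OF that(1-3) _ _ that(7,6)]) auto
    qed (simp_all add: dot_unit_sphere geodesic_dist_nonneg geodesic_dist_self geodesic_dist_triangle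
        geodesic_dist_commute)
  qed
  have Sup: "Sup X = b" using X ab by simp
  have G: "vect_functor K (A \<times> X) r G"
    unfolding assms(7,8)
    by (rule vect_functor_directional_PH[OF K assms(4,5)]) (use top mono Sup X in auto)
  interpret kan_extension K "?S \<times> X" "A \<times> X" r G
  proof (rule kan_extension.intro)
    show "A \<times> X \<subseteq> ?S \<times> X" using assms(5) by auto
    show "r p s" if "p \<in> ?S \<times> X" "q \<in> ?S \<times> X" "s \<in> ?S \<times> X" "r p q" "r q s" for p q s
      using that(4,5) unfolding assms(7)
      by (intro spacetime_le_trans[OF triangle nonneg _ that(1-3)]) (auto simp: Sup X)
  qed (fact K G)+
  have r_refl: "r p p" if "p \<in> ?S \<times> X" for p
    using that refl by (auto simp: assms(7) spacetime_le_def)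
  have lipschitz: "lipschitz1_to_pmod K X ?S \<delta> (\<lambda>w. precomp F (Pair w))"
    if "vect_functor K (?S \<times> X) r F" for F :: "((nat \<Rightarrow> real) \<times> real, 'k, 'v) diagram"
    using spacetime_functor_lipschitz[OF X ab that[unfolded assms(7)] nonneg refl sym] .
  show ?thesis
    using lipschitz[OF vect_functor_left_kan[OF r_refl]] lipschitz[OF vect_functor_right_kan]
      lipschitz[OF vect_functor_center_kan] by blast
qed

end
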